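(* The graph isomorphism problem for connected graphs in $\Gamma_0$ (input: connected $G_1, G_2$; output YES iff $G_1 \simeq G_2$) is polynomial-time many-one reducible to the direct-product compositeness problem for unconnected, nonbipartite graphs in $\Gamma_0$ (input: an unconnected nonbipartite graph $G$; output YES iff $G$ is composite with respect to the direct product).
   Context: $\Gamma_0$ is the set of finite undirected graphs in which self-loops (edges $\{v,v\}$) are allowed. The direct product $G_1 \times G_2$ of graphs $G_1,G_2$ has node set $V(G_1)\times V(G_2)$, and $(x,y)$ is adjacent to $(x',y')$ iff $\{x,x'\}\in E(G_1)$ and $\{y,y'\}\in E(G_2)$. A graph is nontrivial if it has more than one node. A graph $G$ is composite with respect to the direct product if $G \simeq G_1 \times G_2$ for some nontrivial graphs $G_1, G_2$. "Unconnected" means not connected. A polynomial-time many-one reduction from decision problem $S_1$ to $S_2$ is a polynomial-time computable function $f$ such that $x$ is a YES-instance of $S_1$ iff $f(x)$ is a YES-instance of $S_2$. *)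

theory Defs
  imports "Graph_Theory.Graph_Theory" "HOL-Computational_Algebra.Polynomial"
begin

section \<open>Undirected graphs with loops allowed\<close>

text \<open>
  A finite undirected graph in which loops are allowed is a \<^locale>\<open>pair_pseudo_graph\<close>: a finite
  digraph without parallel arcs whose arc relation is symmetric. An edge \<open>{u, v}\<close> is represented by
  the two arcs \<open>(u, v)\<close> and \<open>(v, u)\<close>, a loop \<open>{v, v}\<close> by the single arc \<open>(v, v)\<close>.
\<close>

abbreviation connected_graph :: "'a pair_pre_digraph \<Rightarrow> bool" where
  "connected_graph G \<equiv> Digraph_Component.connected (with_proj G)"

abbreviation graph_iso :: "'a pair_pre_digraph \<Rightarrow> 'b pair_pre_digraph \<Rightarrow> bool" where
  "graph_iso G H \<equiv> digraph_iso (with_proj G) (with_proj H)"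

lemma graph_iso_iff:
  assumes "pair_pseudo_graph G" "pair_pseudo_graph H"
  shows "graph_iso G H \<longleftrightarrow>
    (\<exists>h. bij_betw h (pverts G) (pverts H) \<and>
       (\<forall>u \<in> pverts G. \<forall>v \<in> pverts G. (u, v) \<in> parcs G \<longleftrightarrow> (h u, h v) \<in> parcs H))"
    (is "_ \<longleftrightarrow> ?R")
proof
  interpret G: pair_pseudo_graph G by fact
  assume "graph_iso G H"
  then obtain f where f: "pre_digraph.digraph_isomorphism (with_proj G) f"
    and H: "with_proj H = app_iso f (with_proj G)"
    by (auto simp: digraph_iso_def)
  define h where "h = iso_verts f"
  have V: "pverts H = h ` pverts G" and A: "parcs H = iso_arcs f ` parcs G"
    and t: "iso_tail f = fst" and hd: "iso_head f = snd"
    using arg_cong[OF H, of verts] arg_cong[OF H, of arcs]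
      arg_cong[OF H, of tail] arg_cong[OF H, of head] by (simp_all add: h_def)
  have inj: "inj_on h (pverts G)"
    using f by (simp add: pre_digraph.digraph_isomorphism_def h_def)
  have arc: "iso_arcs f a = (h (fst a), h (snd a))" if "a \<in> parcs G" for a
    using f that by (auto simp: pre_digraph.digraph_isomorphism_def h_def t hd prod_eq_iff)
  have "(u, v) \<in> parcs G \<longleftrightarrow> (h u, h v) \<in> parcs H" if "u \<in> pverts G" "v \<in> pverts G" for u v
  proof
    assume "(u, v) \<in> parcs G"
    then show "(h u, h v) \<in> parcs H" unfolding A by (rule rev_image_eqI) (simp add: arc \<open>(u, v) \<in> parcs G\<close>)
  next
    assume "(h u, h v) \<in> parcs H"
    then obtain a where a: "a \<in> parcs G" "h u = h (fst a)" "h v = h (snd a)"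
      unfolding A using arc by fastforce
    then have "fst a \<in> pverts G" "snd a \<in> pverts G"
      by (auto intro: G.arc_fst_in_verts G.arc_snd_in_verts)
    with a that inj have "u = fst a" "v = snd a" by (auto dest: inj_onD)
    with a show "(u, v) \<in> parcs G" by simp
  qed
  with inj V show ?R by (auto simp: bij_betw_def)
next
  interpret G: pair_pseudo_graph G by fact
  interpret H: pair_pseudo_graph H by fact
  assume ?R
  then obtain h where inj: "inj_on h (pverts G)" and V: "pverts H = h ` pverts G"
    and adj: "\<And>u v. u \<in> pverts G \<Longrightarrow> v \<in> pverts G \<Longrightarrow>
      (u, v) \<in> parcs G \<longleftrightarrow> (h u, h v) \<in> parcs H"
    by (auto simp: bij_betw_def)
  define f where "f = \<lparr> iso_verts = h, iso_arcs = map_prod h h, iso_head = snd, iso_tail = fst \<rparr>"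
  have sub: "parcs G \<subseteq> pverts G \<times> pverts G"
    using G.in_arcsD1 G.in_arcsD2 by auto
  have "parcs H \<subseteq> map_prod h h ` parcs G"
  proof
    fix a assume a: "a \<in> parcs H"
    then have "fst a \<in> pverts H" "snd a \<in> pverts H"
      by (auto intro: H.arc_fst_in_verts H.arc_snd_in_verts)
    then obtain u v where uv: "u \<in> pverts G" "v \<in> pverts G" "a = (h u, h v)"
      unfolding V by (metis imageE prod.collapse)
    with a adj show "a \<in> map_prod h h ` parcs G" by force
  qed
  moreover have "map_prod h h ` parcs G \<subseteq> parcs H"
    using adj sub by auto
  ultimately have A: "parcs H = map_prod h h ` parcs G" by blast
  have "inj_on (map_prod h h) (parcs G)"
    using map_prod_inj_on[OF inj inj] sub by (rule inj_on_subset)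
  then have "pre_digraph.digraph_isomorphism (with_proj G) f"
    using inj G.wf_digraph by (auto simp: pre_digraph.digraph_isomorphism_def f_def)
  moreover have "with_proj H = app_iso f (with_proj G)"
    by (simp add: with_proj_def app_iso_def f_def V A)
  ultimately show "graph_iso G H" by (auto simp: digraph_iso_def)
qed

definition direct_product ::
    "'a pair_pre_digraph \<Rightarrow> 'b pair_pre_digraph \<Rightarrow> ('a \<times> 'b) pair_pre_digraph" where
  "direct_product G H =
     \<lparr> pverts = pverts G \<times> pverts H,
       parcs = {((x, y), (x', y')) | x y x' y'. (x, x') \<in> parcs G \<and> (y, y') \<in> parcs H} \<rparr>"

definition nontrivial :: "'a pair_pre_digraph \<Rightarrow> bool" where
  "nontrivial G \<longleftrightarrow> card (pverts G) > 1"

text \<open>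
  Factors with natural numbers as nodes suffice, since every finite graph is isomorphic to one.
\<close>

definition composite :: "'a pair_pre_digraph \<Rightarrow> bool" where
  "composite G \<longleftrightarrow>
     (\<exists>(G1 :: nat pair_pre_digraph) (G2 :: nat pair_pre_digraph).
        pair_pseudo_graph G1 \<and> pair_pseudo_graph G2 \<and>
        nontrivial G1 \<and> nontrivial G2 \<and>
        graph_iso G (direct_product G1 G2))"

definition bipartite :: "'a pair_pre_digraph \<Rightarrow> bool" where
  "bipartite G \<longleftrightarrow>
     (\<exists>A B. A \<union> B = pverts G \<and> A \<inter> B = {} \<and>
        (\<forall>(u, v) \<in> parcs G. u \<in> A \<and> v \<in> B \<or> u \<in> B \<and> v \<in> A))"

lemma pair_pseudo_graph_direct_product:
  assumes "pair_pseudo_graph G" "pair_pseudo_graph H"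
  shows "pair_pseudo_graph (direct_product G H)"
proof -
  interpret G: pair_pseudo_graph G by fact
  interpret H: pair_pseudo_graph H by fact
  have sub: "parcs (direct_product G H) \<subseteq>
      pverts (direct_product G H) \<times> pverts (direct_product G H)"
    by (auto simp: direct_product_def dest: G.in_arcsD1 G.in_arcsD2 H.in_arcsD1 H.in_arcsD2)
  have fin: "finite (pverts (direct_product G H))"
    by (simp add: direct_product_def G.pair_finite_verts H.pair_finite_verts)
  have "sym (parcs G)" "sym (parcs H)"
    using G.pair_sym_arcs H.pair_sym_arcs by (simp_all add: symmetric_def)
  then have "sym (parcs (direct_product G H))"
    by (auto simp: direct_product_def sym_def)
  with sub fin show ?thesis
    by unfold_locales (auto simp: symmetric_def intro: finite_subset)
qed

section \<open>Encoding of graphs as bit strings\<close>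

definition numbered_graph :: "nat pair_pre_digraph \<Rightarrow> bool" where
  "numbered_graph G \<longleftrightarrow> pair_pseudo_graph G \<and> (\<exists>n. pverts G = {..<n})"

text \<open>
  The number \<open>n\<close> of nodes in unary, a separator, and the adjacency matrix row by row. The code is
  self-delimiting, so a pair of graphs is encoded by concatenation.
\<close>

definition graph_code :: "nat pair_pre_digraph \<Rightarrow> bool list" where
  "graph_code G =
     (let n = card (pverts G) in
        replicate n True @ False #
        map (\<lambda>(i, j). (i, j) \<in> parcs G) (List.product [0..<n] [0..<n]))"

lemma replicate_True_eq:
  "replicate m True @ False # xs = replicate n True @ False # ys \<Longrightarrow> m = n \<and> xs = ys"
proof (induction m arbitrary: n)
  case 0
  then show ?case by (cases n) auto
next
  case (Suc m)
  then show ?case by (cases n) auto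
qed

lemma graph_code_append_inject:
  assumes G: "numbered_graph G" and H: "numbered_graph H"
    and eq: "graph_code G @ xs = graph_code H @ ys"
  shows "G = H \<and> xs = ys"
proof -
  let ?mat = "\<lambda>G n. map (\<lambda>(i, j). (i, j) \<in> parcs G) (List.product [0..<n] [0..<n])"
  from G obtain n where n: "pverts G = {..<n}" and wfG: "pair_pseudo_graph G"
    by (auto simp: numbered_graph_def)
  from H obtain m where m: "pverts H = {..<m}" and wfH: "pair_pseudo_graph H"
    by (auto simp: numbered_graph_def)
  interpret G: pair_pseudo_graph G by fact
  interpret H: pair_pseudo_graph H by fact
  have "n = m \<and> ?mat G n @ xs = ?mat H m @ ys"
    using eq n m by (intro replicate_True_eq) (simp add: graph_code_def Let_def)
  then have [simp]: "m = n" and mat: "?mat G n = ?mat H n" and "xs = ys"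
    by auto
  have "(i, j) \<in> parcs G \<longleftrightarrow> (i, j) \<in> parcs H" if "i < n" "j < n" for i j
    using mat that by auto
  moreover have "parcs G \<subseteq> {..<n} \<times> {..<n}" "parcs H \<subseteq> {..<n} \<times> {..<n}"
    using G.in_arcsD1 G.in_arcsD2 H.in_arcsD1 H.in_arcsD2 n m by auto
  ultimately have "parcs G = parcs H" by blast
  with n m \<open>xs = ys\<close> show ?thesis by simp
qed

section \<open>Polynomial-time computability\<close>

text \<open>
  Deterministic Turing machines with several two-way infinite tapes. Symbol \<open>0\<close> is the blank, \<open>1\<close>
  and \<open>2\<close> represent the bits, and further work symbols are allowed. State \<open>0\<close> is the initial state,
  the states below \<open>num_states\<close> are active and \<open>num_states\<close> itself is the halting state.
\<close>

datatype move = MoveLeft | Stay | MoveRight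

record turing_machine =
  num_tapes :: nat
  num_symbols :: nat
  num_states :: nat
  transition :: "nat \<Rightarrow> nat list \<Rightarrow> nat \<times> (nat \<times> move) list"

definition wf_tm :: "turing_machine \<Rightarrow> bool" where
  "wf_tm M \<longleftrightarrow> num_tapes M \<ge> 2 \<and> num_symbols M \<ge> 3 \<and>
     (\<forall>q < num_states M. \<forall>ss. length ss = num_tapes M \<and> set ss \<subseteq> {..<num_symbols M} \<longrightarrow>
        (case transition M q ss of (q', as) \<Rightarrow>
           q' \<le> num_states M \<and> length as = num_tapes M \<and> fst ` set as \<subseteq> {..<num_symbols M}))"

text \<open>A tape consists of the contents of its cells and the position of the head.\<close>

type_synonym tape = "(int \<Rightarrow> nat) \<times> int"

fun act :: "nat \<times> move \<Rightarrow> tape \<Rightarrow> tape" where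
  "act (s, d) (c, h) =
     (c(h := s), case d of MoveLeft \<Rightarrow> h - 1 | Stay \<Rightarrow> h | MoveRight \<Rightarrow> h + 1)"

definition step :: "turing_machine \<Rightarrow> nat \<times> tape list \<Rightarrow> nat \<times> tape list" where
  "step M = (\<lambda>(q, ts).
     if q < num_states M
     then (case transition M q (map (\<lambda>(c, h). c h) ts) of (q', as) \<Rightarrow> (q', map2 act as ts))
     else (q, ts))"

definition cells_of :: "bool list \<Rightarrow> int \<Rightarrow> nat" where
  "cells_of x i = (if 0 \<le> i \<and> i < int (length x) then (if x ! nat i then 2 else 1) else 0)"

definition start_config :: "turing_machine \<Rightarrow> bool list \<Rightarrow> nat \<times> tape list" where
  "start_config M x = (0, (cells_of x, 0) # replicate (num_tapes M - 1) (cells_of [], 0))"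

text \<open>
  The input is on the first tape, the output on the second one. A halted machine does not change its
  configuration any more, hence having halted at time \<open>t\<close> means halting within \<open>t\<close> steps.
\<close>

definition outputs_within :: "turing_machine \<Rightarrow> bool list \<Rightarrow> nat \<Rightarrow> bool list \<Rightarrow> bool" where
  "outputs_within M x t y \<longleftrightarrow>
     (case (step M ^^ t) (start_config M x) of (q, ts) \<Rightarrow>
        q = num_states M \<and> fst (ts ! 1) = cells_of y)"

definition polytime_computable :: "(bool list \<Rightarrow> bool list) \<Rightarrow> bool" where
  "polytime_computable f \<longleftrightarrow>
     (\<exists>M (p :: nat poly). wf_tm M \<and> (\<forall>x. outputs_within M x (poly p (length x)) (f x)))"

section \<open>Decision problems and reductions\<close>

text \<open>
  A decision problem consists of the set of (codes of) admissible inputs and the subset of those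
  with answer YES. A reduction maps admissible inputs to admissible inputs; it is a function
  on all bit strings, but its values on strings that are not admissible inputs are irrelevant.
\<close>

record decision_problem =
  instances :: "bool list set"
  yes_instances :: "bool list set"

definition polytime_reducible :: "decision_problem \<Rightarrow> decision_problem \<Rightarrow> bool" where
  "polytime_reducible S1 S2 \<longleftrightarrow>
     (\<exists>f. polytime_computable f \<and>
        (\<forall>x \<in> instances S1.
           f x \<in> instances S2 \<and> (x \<in> yes_instances S1 \<longleftrightarrow> f x \<in> yes_instances S2)))"

definition connected_graph_isomorphism :: decision_problem where
  "connected_graph_isomorphism =
     \<lparr> instances = {graph_code G1 @ graph_code G2 | G1 G2.
         numbered_graph G1 \<and> connected_graph G1 \<and>
         numbered_graph G2 \<and> connected_graph G2},
       yes_instances = {graph_code G1 @ graph_code G2 | G1 G2.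
         numbered_graph G1 \<and> connected_graph G1 \<and>
         numbered_graph G2 \<and> connected_graph G2 \<and> graph_iso G1 G2} \<rparr>"

definition unconnected_nonbipartite_compositeness :: decision_problem where
  "unconnected_nonbipartite_compositeness =
     \<lparr> instances = {graph_code G | G.
         numbered_graph G \<and> \<not> connected_graph G \<and> \<not> bipartite G},
       yes_instances = {graph_code G | G.
         numbered_graph G \<and> \<not> connected_graph G \<and> \<not> bipartite G \<and> composite G} \<rparr>"

end

theory Submission
  imports Defs
begin

text \<open>
  To each graph add a node \<open>u\<close> adjacent to all nodes including itself, and a node \<open>x\<close> adjacent to all
  nodes except itself; the reduction outputs the disjoint union of the two cones obtained in this way.
  If the cones are isomorphic, the union is the product of one of them with two isolated loops.
  Conversely, neighbourhoods in a product are boxes. The neighbourhoods of the two nodes \<open>u\<close> partition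
  the product, so both have full width in the same factor \<open>A\<close>; since a box without one of its points is
  not a box unless one of its sides is a single point, the neighbourhoods of the two nodes \<open>x\<close> show that
  both cones are isomorphic to \<open>A\<close>. Nodes with the same adjacencies can be exchanged, so an isomorphism of
  the cones can be made to respect the added nodes.

  For the running time, the reduction is a program in a small structured language whose loops run at
  most as often as the input is long; such a program compiles to a Turing machine with a polynomial
  time bound that can be read off the nesting of its loops.
\<close>

section \<open>Cones and their disjoint unions\<close>

text \<open>The added nodes \<open>u\<close> and \<open>x\<close> are \<open>n\<close> and \<open>Suc n\<close>.\<close>

definition cone_adj :: "nat \<Rightarrow> (nat \<Rightarrow> nat \<Rightarrow> bool) \<Rightarrow> nat \<Rightarrow> nat \<Rightarrow> bool" where
  "cone_adj n E i j \<longleftrightarrow> (if i < n \<and> j < n then E i j else \<not> (i = Suc n \<and> j = Suc n))"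

definition union_adj :: "nat \<Rightarrow> (nat \<Rightarrow> nat \<Rightarrow> bool) \<Rightarrow> (nat \<Rightarrow> nat \<Rightarrow> bool) \<Rightarrow> nat \<Rightarrow> nat \<Rightarrow> bool" where
  "union_adj k E F i j \<longleftrightarrow> (i < k \<longleftrightarrow> j < k) \<and> (if i < k then E i j else F (i - k) (j - k))"

definition cone_union_adj ::
    "nat \<Rightarrow> (nat \<Rightarrow> nat \<Rightarrow> bool) \<Rightarrow> nat \<Rightarrow> (nat \<Rightarrow> nat \<Rightarrow> bool) \<Rightarrow> nat \<Rightarrow> nat \<Rightarrow> bool" where
  "cone_union_adj n E m F = union_adj (n + 2) (cone_adj n E) (cone_adj m F)"

section \<open>Graphs given by adjacency predicates\<close>

definition graph_of :: "nat \<Rightarrow> (nat \<Rightarrow> nat \<Rightarrow> bool) \<Rightarrow> nat pair_pre_digraph" where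
  "graph_of n E = \<lparr> pverts = {..<n}, parcs = {(i, j). i < n \<and> j < n \<and> E i j} \<rparr>"

lemma pair_pseudo_graph_graph_of:
  assumes "\<And>i j. i < n \<Longrightarrow> j < n \<Longrightarrow> E i j \<Longrightarrow> E j i"
  shows "pair_pseudo_graph (graph_of n E)"
proof
  have "parcs (graph_of n E) \<subseteq> {..<n} \<times> {..<n}"
    by (auto simp: graph_of_def)
  then show "finite (parcs (graph_of n E))"
    by (rule finite_subset) simp
qed (auto simp: graph_of_def symmetric_def sym_def assms)

text \<open>Membership in the arc set serves as \<open>E\<close>. It fails outside the node range,
  so symmetry holds for all numbers and later lemmas can assume it without bounds.\<close>

lemma numbered_graph_of_adj:
  assumes "numbered_graph G"
  obtains n E where "G = graph_of n E" "\<And>i j. E i j \<Longrightarrow> E j i"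
proof -
  from assms obtain n where n: "pverts G = {..<n}" and G: "pair_pseudo_graph G"
    by (auto simp: numbered_graph_def)
  interpret pair_pseudo_graph G by fact
  have "parcs G \<subseteq> {..<n} \<times> {..<n}"
    using in_arcsD1 in_arcsD2 n by auto
  then have "G = graph_of n (\<lambda>i j. (i, j) \<in> parcs G)"
    using n by (auto simp: graph_of_def intro!: pair_pre_digraph.equality)
  moreover have "(j, i) \<in> parcs G" if "(i, j) \<in> parcs G" for i j
    using pair_sym_arcs that by (auto simp: symmetric_def sym_def)
  ultimately show thesis
    using that by blast
qed

definition adj_iso ::
    "nat \<Rightarrow> (nat \<Rightarrow> nat \<Rightarrow> bool) \<Rightarrow> nat \<Rightarrow> (nat \<Rightarrow> nat \<Rightarrow> bool) \<Rightarrow> bool" where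
  "adj_iso n E m F \<longleftrightarrow>
     (\<exists>h. bij_betw h {..<n} {..<m} \<and> (\<forall>i<n. \<forall>j<n. E i j \<longleftrightarrow> F (h i) (h j)))"

lemma adj_iso_sym:
  assumes "adj_iso n E m F"
  shows "adj_iso m F n E"
proof -
  obtain h where h: "bij_betw h {..<n} {..<m}"
      "\<And>i j. i < n \<Longrightarrow> j < n \<Longrightarrow> E i j \<longleftrightarrow> F (h i) (h j)"
    using assms by (auto simp: adj_iso_def)
  let ?g = "inv_into {..<n} h"
  have g: "bij_betw ?g {..<m} {..<n}"
    using h(1) by (rule bij_betw_inv_into)
  have "F i j \<longleftrightarrow> E (?g i) (?g j)" if "i < m" "j < m" for i j
  proof -
    have "?g i < n" "?g j < n" "h (?g i) = i" "h (?g j) = j"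
      using g h(1) that by (auto simp: bij_betw_def f_inv_into_f)
    then show ?thesis
      using h(2)[of "?g i" "?g j"] by simp
  qed
  with g show ?thesis
    by (auto simp: adj_iso_def)
qed

lemma graph_iso_graph_of:
  assumes "\<And>i j. E i j \<Longrightarrow> E j i" "\<And>i j. F i j \<Longrightarrow> F j i"
  shows "graph_iso (graph_of n E) (graph_of m F) \<longleftrightarrow>
    adj_iso n E m F"
proof -
  have "graph_iso (graph_of n E) (graph_of m F) \<longleftrightarrow>
    (\<exists>h. bij_betw h {..<n} {..<m} \<and>
      (\<forall>i<n. \<forall>j<n. E i j \<longleftrightarrow> h i < m \<and> h j < m \<and> F (h i) (h j)))"
    by (subst graph_iso_iff[OF pair_pseudo_graph_graph_of pair_pseudo_graph_graph_of])
      (use assms in \<open>auto simp: graph_of_def\<close>)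
  also have "\<dots> \<longleftrightarrow> adj_iso n E m F"
    unfolding adj_iso_def by (meson bij_betwE lessThan_iff)
  finally show ?thesis .
qed

lemma cone_adj_sym: "(\<And>i j. E i j \<Longrightarrow> E j i) \<Longrightarrow> cone_adj n E i j \<Longrightarrow> cone_adj n E j i"
  by (auto simp: cone_adj_def split: if_splits)

lemma cone_union_adj_sym:
  "(\<And>i j. E i j \<Longrightarrow> E j i) \<Longrightarrow> (\<And>i j. F i j \<Longrightarrow> F j i) \<Longrightarrow>
    cone_union_adj n E m F i j \<Longrightarrow> cone_union_adj n E m F j i"
  by (auto simp: cone_union_adj_def union_adj_def cone_adj_sym split: if_splits)

text \<open>Adjacency never leaves the block of nodes below \<open>k\<close>, so no walk leads from
  \<open>0\<close> to \<open>k\<close>. The bounds on \<open>k\<close> say that both blocks are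
  inhabited.\<close>

lemma not_connected_graph_of_union:
  assumes "0 < k" "k < N"
  shows "\<not> connected_graph (graph_of N (union_adj k E F))"
proof
  let ?G = "with_proj (graph_of N (union_adj k E F))"
  assume "connected_graph (graph_of N (union_adj k E F))"
  then have "strongly_connected (mk_symmetric ?G)"
    by (simp add: connected_def)
  then have "0 \<rightarrow>\<^sup>*\<^bsub>mk_symmetric ?G\<^esub> k"
    using assms by (auto simp: strongly_connected_def graph_of_def)
  moreover have "v < k" if "0 \<rightarrow>\<^sup>*\<^bsub>mk_symmetric ?G\<^esub> v" for v
    using that unfolding reachable_def
  proof (induction rule: rtrancl_on_induct)
    case (step u v)
    then show ?case
      by (auto simp: parcs_mk_symmetric graph_of_def union_adj_def)
  qed (use assms in simp)
  ultimately show False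
    by blast
qed

lemma not_bipartite_loop: "(v, v) \<in> parcs G \<Longrightarrow> \<not> bipartite G"
  by (auto simp: bipartite_def)

section \<open>Boxes in products of sets\<close>

lemma box_partition:
  assumes ne: "A1 \<times> B1 \<noteq> {}" "A2 \<times> B2 \<noteq> {}"
    and un: "A1 \<times> B1 \<union> A2 \<times> B2 = A \<times> B" and disj: "A1 \<times> B1 \<inter> A2 \<times> B2 = {}"
  shows "A1 = A \<and> A2 = A \<or> B1 = B \<and> B2 = B"
proof -
  have sub: "A1 \<subseteq> A" "A2 \<subseteq> A" "B1 \<subseteq> B" "B2 \<subseteq> B"
    using ne un by blast+
  \<comment> \<open>Boxes that share a value in each coordinate share a point.\<close>
  consider "A1 \<inter> A2 = {}" | "B1 \<inter> B2 = {}"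
    using disj by blast
  then show ?thesis
  proof cases
    case 1
    \<comment> \<open>Over a point of \<open>A1\<close> the second box is empty, so the first one
      contains all of \<open>B\<close> there; likewise over a point of \<open>A2\<close>.\<close>
    have "B \<subseteq> B1" "B \<subseteq> B2"
      using 1 ne un by blast+
    then show ?thesis
      using sub by blast
  next
    case 2
    have "A \<subseteq> A1" "A \<subseteq> A2"
      using 2 ne un by blast+
    then show ?thesis
      using sub by blast
  qed
qed

text \<open>A box containing \<open>(a, b')\<close> and \<open>(a', b)\<close> also contains the
  corner \<open>(a, b)\<close>, which is the point removed.\<close>

lemma box_minus_point:
  assumes "A1 \<times> B1 = A \<times> B - {(a, b)}" "a \<in> A" "b \<in> B" "A \<noteq> {a}"
  shows "B = {b}"
proof (rule ccontr)
  assume "B \<noteq> {b}"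
  with assms obtain a' b' where "a' \<in> A" "a' \<noteq> a" "b' \<in> B" "b' \<noteq> b"
    by blast
  then have "(a, b') \<in> A1 \<times> B1" "(a', b) \<in> A1 \<times> B1"
    unfolding assms(1) using assms by auto
  then have "(a, b) \<in> A1 \<times> B1"
    by blast
  then show False
    unfolding assms(1) by simp
qed

section \<open>Isomorphisms of cones\<close>

lemma adj_iso_fix:
  assumes h: "bij_betw h X Y" and adj: "\<And>p q. p \<in> X \<Longrightarrow> q \<in> X \<Longrightarrow> E p q \<longleftrightarrow> F (h p) (h q)"
    and v: "v \<in> X" and w: "w \<in> Y"
    and twin: "\<And>p q. p \<in> Y \<Longrightarrow> q \<in> Y \<Longrightarrow>
      F (transpose (h v) w p) (transpose (h v) w q) \<longleftrightarrow> F p q"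
  obtains k where "bij_betw k X Y" "\<And>p q. p \<in> X \<Longrightarrow> q \<in> X \<Longrightarrow> E p q \<longleftrightarrow> F (k p) (k q)"
    "k v = w" "\<And>u. u \<in> X \<Longrightarrow> h u \<noteq> h v \<Longrightarrow> h u \<noteq> w \<Longrightarrow> k u = h u"
proof (rule that)
  have hv: "h v \<in> Y"
    using h v by (auto simp: bij_betw_def)
  \<comment> \<open>The new map is \<open>h\<close> followed by the exchange of \<open>h v\<close>
    and \<open>w\<close>, an automorphism by \<open>twin\<close>. That all other values stay
    unchanged is recorded so that a second repair preserves the first.\<close>
  have "transpose (h v) w permutes Y"
    using hv w by (rule permutes_swap_id)
  then show "bij_betw (transpose (h v) w \<circ> h) X Y"
    using h by (blast intro: bij_betw_trans permutes_imp_bij)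
  show "E p q \<longleftrightarrow> F ((transpose (h v) w \<circ> h) p) ((transpose (h v) w \<circ> h) q)"
    if "p \<in> X" "q \<in> X" for p q
    using twin[of "h p" "h q"] adj[OF that] h that by (auto simp: bij_betw_def)
qed (simp_all add: transpose_def)

text \<open>Being adjacent to everything, or to everything but itself, determines all adjacencies of
  a node, so two nodes sharing such a property can be exchanged. Two exchanges make the map send
  \<open>n\<close> to \<open>m\<close> and \<open>Suc n\<close> to \<open>Suc m\<close>; its
  restriction to the other nodes is the isomorphism sought.\<close>

lemma adj_iso_cone_imp:
  assumes "adj_iso (n + 2) (cone_adj n E) (m + 2) (cone_adj m F)"
  shows "adj_iso n E m F"
proof -
  obtain h where h: "bij_betw h {..<n + 2} {..<m + 2}"
    and adj: "\<And>i j. i < n + 2 \<Longrightarrow> j < n + 2 \<Longrightarrow> cone_adj n E i j \<longleftrightarrow> cone_adj m F (h i) (h j)"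
    using assms by (auto simp: adj_iso_def)
  let ?E = "cone_adj n E" and ?F = "cone_adj m F"
  have hn: "h n < m + 2"
    using h by (auto simp: bij_betw_def)
  have universal: "?F (h n) q" "?F q (h n)" if "q < m + 2" for q
  proof -
    obtain j where "j < n + 2" "q = h j"
      using h \<open>q < m + 2\<close> by (auto simp: bij_betw_def)
    then show "?F (h n) q" "?F q (h n)"
      using adj[of n j] adj[of j n] by (auto simp: cone_adj_def)
  qed
  have m: "?F m q" "?F q m" for q
    by (auto simp: cone_adj_def)
  obtain k where k: "bij_betw k {..<n + 2} {..<m + 2}"
    and adjk: "\<And>i j. i < n + 2 \<Longrightarrow> j < n + 2 \<Longrightarrow> ?E i j \<longleftrightarrow> ?F (k i) (k j)" and kn: "k n = m"
  proof (rule adj_iso_fix[OF h, of ?E ?F n m])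
    show "?F (transpose (h n) m p) (transpose (h n) m q) \<longleftrightarrow> ?F p q"
      if "p \<in> {..<m + 2}" "q \<in> {..<m + 2}" for p q
      using universal m that hn by (auto simp: transpose_def)
  qed (use adj in auto)
  define w where "w = k (Suc n)"
  have w: "w < m + 2"
    using k by (auto simp: bij_betw_def w_def)
  have almost_universal: "?F w q \<longleftrightarrow> q \<noteq> w" "?F q w \<longleftrightarrow> q \<noteq> w" if "q < m + 2" for q
  proof -
    obtain j where j: "j < n + 2" "q = k j"
      using k \<open>q < m + 2\<close> by (auto simp: bij_betw_def)
    moreover have "q = w \<longleftrightarrow> j = Suc n"
      using k j by (auto simp: bij_betw_def w_def inj_on_def)
    ultimately show "?F w q \<longleftrightarrow> q \<noteq> w" "?F q w \<longleftrightarrow> q \<noteq> w"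
      using adjk[of "Suc n" j] adjk[of j "Suc n"] by (auto simp: cone_adj_def w_def)
  qed
  have Sm: "?F (Suc m) q \<longleftrightarrow> q \<noteq> Suc m" "?F q (Suc m) \<longleftrightarrow> q \<noteq> Suc m" if "q < m + 2" for q
    by (auto simp: cone_adj_def)
  \<comment> \<open>The node \<open>m\<close> has a loop and \<open>w\<close> has none; hence the
    second exchange does not disturb \<open>k n = m\<close>.\<close>
  have "w \<noteq> m"
    using almost_universal(1)[of w] w m by auto
  obtain l where l: "bij_betw l {..<n + 2} {..<m + 2}"
    and adjl: "\<And>i j. i < n + 2 \<Longrightarrow> j < n + 2 \<Longrightarrow> ?E i j \<longleftrightarrow> ?F (l i) (l j)"
    and lSn: "l (Suc n) = Suc m"
    and rest: "\<And>i. i < n + 2 \<Longrightarrow> k i \<noteq> w \<Longrightarrow> k i \<noteq> Suc m \<Longrightarrow> l i = k i"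
  proof (rule adj_iso_fix[OF k, of ?E ?F "Suc n" "Suc m"])
    show "?F (transpose (k (Suc n)) (Suc m) p) (transpose (k (Suc n)) (Suc m) q) \<longleftrightarrow> ?F p q"
      if "p \<in> {..<m + 2}" "q \<in> {..<m + 2}" for p q
      using almost_universal Sm w that by (auto simp: transpose_def w_def[symmetric])
  qed (use adjk in \<open>auto simp: w_def\<close>)
  have ln: "l n = m"
    using rest[of n] kn \<open>w \<noteq> m\<close> by auto
  have "bij_betw l ({..<n + 2} - {n, Suc n}) ({..<m + 2} - {m, Suc m})"
    using bij_betw_DiffI[OF l, of "{n, Suc n}" "{m, Suc m}"] l ln lSn
    by (auto simp: bij_betw_def)
  moreover have "{..<k + 2} - {k, Suc k} = {..<k}" for k :: nat
    by auto
  ultimately have bij: "bij_betw l {..<n} {..<m}"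
    by simp
  then have "l i < m" if "i < n" for i
    using that by (auto simp: bij_betw_def)
  then have "E i j \<longleftrightarrow> F (l i) (l j)" if "i < n" "j < n" for i j
    using adjl[of i j] that by (auto simp: cone_adj_def)
  with bij show ?thesis
    by (auto simp: adj_iso_def)
qed

text \<open>The isomorphism is extended by the identity on the added nodes, which are the same
  numbers in both cones because \<open>m = n\<close>.\<close>

lemma adj_iso_imp_cone:
  assumes "adj_iso n E m F"
  shows "adj_iso (n + 2) (cone_adj n E) (m + 2) (cone_adj m F)"
proof -
  obtain g where g: "bij_betw g {..<n} {..<m}"
      "\<And>i j. i < n \<Longrightarrow> j < n \<Longrightarrow> E i j \<longleftrightarrow> F (g i) (g j)"
    using assms by (auto simp: adj_iso_def)
  have m: "m = n"
    using bij_betw_same_card[OF g(1)] by simp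
  define h where "h = (\<lambda>i. if i < n then g i else i)"
  have "bij_betw h {..<n} {..<n}"
    using g(1) m by (subst bij_betw_cong[of _ _ g]) (auto simp: h_def)
  moreover have "bij_betw h {n..<n + 2} {n..<n + 2}"
    by (auto simp: h_def bij_betw_def inj_on_def)
  ultimately have "bij_betw h ({..<n} \<union> {n..<n + 2}) ({..<n} \<union> {n..<n + 2})"
    by (rule bij_betw_combine) auto
  moreover have "{..<n} \<union> {n..<n + 2} = {..<n + 2}"
    by auto
  ultimately have "bij_betw h {..<n + 2} {..<m + 2}"
    using m by simp
  moreover have "g i < n" if "i < n" for i
    using g(1) m that by (auto simp: bij_betw_def)
  then have "cone_adj n E i j \<longleftrightarrow> cone_adj m F (h i) (h j)" for i j
    using g(2) m by (fastforce simp: cone_adj_def h_def)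
  ultimately show ?thesis
    by (auto simp: adj_iso_def)
qed

section \<open>From a factorization to an isomorphism\<close>

lemma product_neighbourhood:
  assumes h: "h ` V = VA \<times> VB" and "EA \<subseteq> VA \<times> VA" "EB \<subseteq> VB \<times> VB"
    and adj: "\<And>u v. u \<in> V \<Longrightarrow> v \<in> V \<Longrightarrow>
      U u v \<longleftrightarrow> (fst (h u), fst (h v)) \<in> EA \<and> (snd (h u), snd (h v)) \<in> EB"
    and "u \<in> V"
  shows "h ` {v \<in> V. U u v} = EA `` {fst (h u)} \<times> EB `` {snd (h u)}"
proof (intro set_eqI iffI)
  fix p
  assume "p \<in> h ` {v \<in> V. U u v}"
  then show "p \<in> EA `` {fst (h u)} \<times> EB `` {snd (h u)}"
    using adj[OF \<open>u \<in> V\<close>] by (auto simp: mem_Times_iff)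
next
  fix p
  assume p: "p \<in> EA `` {fst (h u)} \<times> EB `` {snd (h u)}"
  \<comment> \<open>Arcs end in nodes of the factors, so \<open>p\<close> is the image of some
    node.\<close>
  then have "p \<in> h ` V"
    using assms(1-3) by auto
  then obtain v where "v \<in> V" "p = h v"
    by blast
  then show "p \<in> h ` {v \<in> V. U u v}"
    using p adj[OF \<open>u \<in> V\<close> \<open>v \<in> V\<close>] by (auto simp: mem_Times_iff)
qed

text \<open>Here \<open>S\<close> is a block with added nodes \<open>u\<close> and \<open>x\<close>.
  Its image is the neighbourhood of \<open>h u\<close>, a box of full width \<open>VA\<close>. The
  neighbourhood of \<open>h x\<close> is this box without the point \<open>h x\<close> and is a box
  too, so \<open>box_minus_point\<close> leaves a single value in the second coordinate.\<close>

lemma cone_block_prime: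
  assumes h: "bij_betw h V (VA \<times> VB)" and sub: "EA \<subseteq> VA \<times> VA" "EB \<subseteq> VB \<times> VB"
    and adj: "\<And>u v. u \<in> V \<Longrightarrow> v \<in> V \<Longrightarrow>
      U u v \<longleftrightarrow> (fst (h u), fst (h v)) \<in> EA \<and> (snd (h u), snd (h v)) \<in> EB"
    and S: "S \<subseteq> V" "u \<in> S" "x \<in> S"
    and u: "\<And>v. v \<in> V \<Longrightarrow> U u v \<longleftrightarrow> v \<in> S"
    and x: "\<And>v. v \<in> V \<Longrightarrow> U x v \<longleftrightarrow> v \<in> S \<and> v \<noteq> x"
    and full: "EA `` {fst (h u)} = VA" and VA: "\<And>a. VA \<noteq> {a}"
  shows "\<exists>b. (b, b) \<in> EB \<and> h ` S = VA \<times> {b}"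
proof -
  have h': "h ` V = VA \<times> VB" and inj: "inj_on h V"
    using h by (simp_all add: bij_betw_def)
  note nbhd = product_neighbourhood[where U = U, OF h' sub adj]
  have "{v \<in> V. U u v} = S" "{v \<in> V. U x v} = S - {x}"
    using u x S(1) by auto
  then have hS: "h ` S = VA \<times> EB `` {snd (h u)}"
    and hSx: "h ` (S - {x}) = EA `` {fst (h x)} \<times> EB `` {snd (h x)}"
    using nbhd[of u] nbhd[of x] S full by auto
  have "h ` (S - {x}) = h ` S - {h x}"
    using inj_on_image_set_diff[OF inj, of S "{x}"] S by auto
  with hS hSx have minus: "EA `` {fst (h x)} \<times> EB `` {snd (h x)} =
      VA \<times> EB `` {snd (h u)} - {(fst (h x), snd (h x))}"
    by simp
  have "h x \<in> VA \<times> EB `` {snd (h u)}" "h u \<in> VA \<times> EB `` {snd (h u)}"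
    using S hS by blast+
  moreover from this have M: "EB `` {snd (h u)} = {snd (h x)}"
    using VA by (intro box_minus_point[OF minus]) auto
  \<comment> \<open>Since \<open>u\<close> lies in its own block, the only neighbour of
    \<open>snd (h u)\<close> is \<open>snd (h u)\<close> itself. This is the loop at
    \<open>b\<close>.\<close>
  ultimately have "snd (h u) = snd (h x)"
    by (metis mem_Sigma_iff prod.collapse singletonD)
  then show ?thesis
    using M hS by auto
qed

text \<open>The nodes \<open>n\<close> and \<open>n + m + 2\<close> are the two copies of
  \<open>u\<close>, and \<open>Suc n\<close> and \<open>n + m + 3\<close> those of \<open>x\<close>.
  Each block is mapped onto a copy of the first factor over a node with a loop, so both cones carry
  the adjacency \<open>EA\<close>.\<close>

lemma cone_union_product_imp_iso:
  assumes h: "bij_betw h {..<n + m + 4} (VA \<times> VB)"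
    and sub: "EA \<subseteq> VA \<times> VA" "EB \<subseteq> VB \<times> VB"
    and adj: "\<And>u v. u \<in> {..<n + m + 4} \<Longrightarrow> v \<in> {..<n + m + 4} \<Longrightarrow> cone_union_adj n E m F u v \<longleftrightarrow>
      (fst (h u), fst (h v)) \<in> EA \<and> (snd (h u), snd (h v)) \<in> EB"
    and full: "EA `` {fst (h n)} = VA" "EA `` {fst (h (n + m + 2))} = VA"
    and VA: "\<And>a. VA \<noteq> {a}"
  shows "adj_iso (n + 2) (cone_adj n E) (m + 2) (cone_adj m F)"
proof -
  let ?V = "{..<n + m + 4}" and ?S = "{..<n + 2}" and ?T = "{n + 2..<n + m + 4}"
  have "\<exists>b. (b, b) \<in> EB \<and> h ` ?S = VA \<times> {b}"
    by (rule cone_block_prime[OF h sub adj _ _ _ _ _ full(1) VA, where x = "Suc n"])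
      (auto simp: cone_union_adj_def union_adj_def cone_adj_def)
  then obtain b where b: "(b, b) \<in> EB" "h ` ?S = VA \<times> {b}"
    by blast
  have "\<exists>b. (b, b) \<in> EB \<and> h ` ?T = VA \<times> {b}"
    by (rule cone_block_prime[OF h sub adj _ _ _ _ _ full(2) VA, where x = "n + m + 3"])
      (auto simp: cone_union_adj_def union_adj_def cone_adj_def)
  then obtain b' where b': "(b', b') \<in> EB" "h ` ?T = VA \<times> {b'}"
    by blast
  have inj: "inj_on h ?V"
    using h by (simp add: bij_betw_def)
  \<comment> \<open>\<open>g\<close> matches the nodes of the two blocks whose images have the same
    first coordinate.\<close>
  define g where "g i = inv_into ?T h (fst (h i), b')" for i
  have injT: "inj_on h ?T" and injS: "inj_on h ?S"
    by (rule inj_on_subset[OF inj]; auto)+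
  have hT: "bij_betw h ?T (VA \<times> {b'})" and hS: "bij_betw h ?S (VA \<times> {b})"
    using b b' injT injS by (simp_all add: bij_betw_def)
  have "bij_betw (\<lambda>p. (fst p, b')) (VA \<times> {b}) (VA \<times> {b'})"
    by (rule bij_betwI[where g = "\<lambda>p. (fst p, b)"]) auto
  from bij_betw_trans[OF bij_betw_trans[OF hS this] bij_betw_inv_into[OF hT]]
  have g: "bij_betw g ?S ?T"
    by (simp add: g_def[abs_def] comp_def)
  have "bij_betw (\<lambda>j. j - (n + 2)) ?T {..<m + 2}"
    by (rule bij_betwI[where g = "\<lambda>j. j + (n + 2)"]) auto
  from bij_betw_trans[OF g this]
  have "bij_betw (\<lambda>i. g i - (n + 2)) ?S {..<m + 2}"
    by (simp add: comp_def)
  moreover have "cone_adj n E i j \<longleftrightarrow> cone_adj m F (g i - (n + 2)) (g j - (n + 2))"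
    if ij: "i < n + 2" "j < n + 2" for i j
  proof -
    have gT: "g i \<in> ?T" "g j \<in> ?T"
      using g ij by (auto simp: bij_betw_def)
    have "h i \<in> VA \<times> {b}" "h j \<in> VA \<times> {b}"
      using b(2) ij by blast+
    then have snd: "snd (h i) = b" "snd (h j) = b"
      and img: "(fst (h i), b') \<in> h ` ?T" "(fst (h j), b') \<in> h ` ?T"
      unfolding b'(2) by auto
    have hg: "h (g i) = (fst (h i), b')" "h (g j) = (fst (h j), b')"
      unfolding g_def by (rule f_inv_into_f[OF img(1)] f_inv_into_f[OF img(2)])+
    have "cone_adj n E i j \<longleftrightarrow> cone_union_adj n E m F i j"
      using ij by (simp add: cone_union_adj_def union_adj_def)
    \<comment> \<open>The loops at \<open>b\<close> and \<open>b'\<close> satisfy the condition on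
      the second coordinate, and the first coordinates agree.\<close>
    also have "\<dots> \<longleftrightarrow> cone_union_adj n E m F (g i) (g j)"
      using adj[of i j] adj[of "g i" "g j"] ij gT hg snd b(1) b'(1) by simp
    also have "\<dots> \<longleftrightarrow> cone_adj m F (g i - (n + 2)) (g j - (n + 2))"
      using gT by (simp add: cone_union_adj_def union_adj_def)
    finally show ?thesis .
  qed
  ultimately show ?thesis
    by (auto simp: adj_iso_def)
qed

lemma composite_cone_union_imp:
  assumes E: "\<And>i j. E i j \<Longrightarrow> E j i" and F: "\<And>i j. F i j \<Longrightarrow> F j i"
    and "composite (graph_of (n + m + 4) (cone_union_adj n E m F))"
  shows "adj_iso n E m F"
proof -
  let ?V = "{..<n + m + 4}" and ?U = "cone_union_adj n E m F"
  from assms(3) obtain A B :: "nat pair_pre_digraph" where A: "pair_pseudo_graph A" "nontrivial A"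
    and B: "pair_pseudo_graph B" "nontrivial B"
    and iso: "graph_iso (graph_of (n + m + 4) ?U) (direct_product A B)"
    by (auto simp: composite_def)
  interpret A: pair_pseudo_graph A by fact
  interpret B: pair_pseudo_graph B by fact
  have sub: "parcs A \<subseteq> pverts A \<times> pverts A" "parcs B \<subseteq> pverts B \<times> pverts B"
    using A.in_arcsD1 A.in_arcsD2 B.in_arcsD1 B.in_arcsD2 by auto
  have nt: "pverts A \<noteq> {a}" "pverts B \<noteq> {a}" for a
    using A(2) B(2) by (auto simp: nontrivial_def)
  have "pair_pseudo_graph (graph_of (n + m + 4) ?U)"
    using cone_union_adj_sym[of E F, OF E F] by (intro pair_pseudo_graph_graph_of) auto
  from iso[unfolded graph_iso_iff[OF this pair_pseudo_graph_direct_product[OF A(1) B(1)]]]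
  obtain h where h: "bij_betw h ?V (pverts A \<times> pverts B)"
    and adj: "\<And>u v. u \<in> ?V \<Longrightarrow> v \<in> ?V \<Longrightarrow>
      ?U u v \<longleftrightarrow> (fst (h u), fst (h v)) \<in> parcs A \<and> (snd (h u), snd (h v)) \<in> parcs B"
    by (auto simp: graph_of_def direct_product_def prod_eq_iff)
  have h': "h ` ?V = pverts A \<times> pverts B" and inj: "inj_on h ?V"
    using h by (simp_all add: bij_betw_def)
  note nbhd = product_neighbourhood[where U = ?U, OF h' sub adj]
  let ?A = "\<lambda>u. parcs A `` {fst (h u)}" and ?B = "\<lambda>u. parcs B `` {snd (h u)}"
  \<comment> \<open>The neighbourhoods of the two copies of \<open>u\<close> are exactly the two
    blocks, so the blocks are mapped to boxes.\<close>
  have "{v \<in> ?V. ?U n v} = {..<n + 2}" "{v \<in> ?V. ?U (n + m + 2) v} = {n + 2..<n + m + 4}"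
    by (auto simp: cone_union_adj_def union_adj_def cone_adj_def)
  then have boxes: "?A n \<times> ?B n = h ` {..<n + 2}"
      "?A (n + m + 2) \<times> ?B (n + m + 2) = h ` {n + 2..<n + m + 4}"
    using nbhd[of n] nbhd[of "n + m + 2"] by auto
  have "h ` {..<n + 2} \<inter> h ` {n + 2..<n + m + 4} = h ` ({..<n + 2} \<inter> {n + 2..<n + m + 4})"
    by (rule inj_on_image_Int[OF inj, symmetric]) auto
  then have disj: "h ` {..<n + 2} \<inter> h ` {n + 2..<n + m + 4} = {}"
    by auto
  have "{..<n + 2} \<union> {n + 2..<n + m + 4} = ?V"
    by auto
  then have un: "h ` {..<n + 2} \<union> h ` {n + 2..<n + m + 4} = pverts A \<times> pverts B"
    unfolding image_Un[symmetric] h'[symmetric] by simp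
  consider "?A n = pverts A" "?A (n + m + 2) = pverts A"
    | "?B n = pverts B" "?B (n + m + 2) = pverts B"
    using box_partition[of "?A n" "?B n" "?A (n + m + 2)" "?B (n + m + 2)" "pverts A" "pverts B",
        unfolded boxes, OF _ _ un disj] by fastforce
  then have "adj_iso (n + 2) (cone_adj n E) (m + 2) (cone_adj m F)"
  proof cases
    case 1
    show ?thesis
      by (rule cone_union_product_imp_iso[OF h sub adj 1 nt(1)])
  next
    case 2
    \<comment> \<open>The full factor is \<open>B\<close> here; exchanging the factors reduces this
      to the first case.\<close>
    have "bij_betw prod.swap (pverts A \<times> pverts B) (pverts B \<times> pverts A)"
      by (rule bij_betwI[where g = prod.swap]) auto
    from bij_betw_trans[OF h this] show ?thesis
      by (rule cone_union_product_imp_iso[OF _ sub(2,1) _ _ _ nt(2)])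
        (use adj 2 in auto)
  qed
  then show ?thesis
    by (rule adj_iso_cone_imp)
qed

section \<open>From an isomorphism to a factorization\<close>

lemma composite_cone_union:
  assumes E: "\<And>i j. E i j \<Longrightarrow> E j i" and F: "\<And>i j. F i j \<Longrightarrow> F j i"
    and "adj_iso n E m F"
  shows "composite (graph_of (n + m + 4) (cone_union_adj n E m F))"
proof -
  let ?V = "{..<n + m + 4}" and ?U = "cone_union_adj n E m F"
  \<comment> \<open>\<open>?A\<close> consists of two isolated loops, so the product is two disjoint
    copies of the cone \<open>?B\<close>. The added nodes make \<open>?B\<close> nontrivial even for
    \<open>n = 0\<close>.\<close>
  let ?A = "graph_of 2 (=)" and ?B = "graph_of (n + 2) (cone_adj n E)"
  obtain g where g: "bij_betw g {..<m + 2} {..<n + 2}"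
      "\<And>i j. i < m + 2 \<Longrightarrow> j < m + 2 \<Longrightarrow> cone_adj m F i j \<longleftrightarrow> cone_adj n E (g i) (g j)"
    using adj_iso_sym[OF adj_iso_imp_cone[OF assms(3)]] by (auto simp: adj_iso_def)
  \<comment> \<open>The first block becomes copy \<open>0\<close> as it stands and the second
    becomes copy \<open>1\<close> along \<open>g\<close>; this is why \<open>g\<close> leads from
    the cone of \<open>F\<close> to that of \<open>E\<close>.\<close>
  define h :: "nat \<Rightarrow> nat \<times> nat" where
    "h v = (if v < n + 2 then (0, v) else (1, g (v - (n + 2))))" for v
  have "bij_betw (\<lambda>j. j - (n + 2)) {n + 2..<n + m + 4} {..<m + 2}"
    by (rule bij_betwI[where g = "\<lambda>j. j + (n + 2)"]) auto
  moreover have "bij_betw (Pair (1 :: nat)) {..<n + 2} ({1} \<times> {..<n + 2})"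
    by (auto simp: bij_betw_def inj_on_def)
  ultimately have "bij_betw (\<lambda>j. (1 :: nat, g (j - (n + 2)))) {n + 2..<n + m + 4} ({1} \<times> {..<n + 2})"
    using bij_betw_trans[OF bij_betw_trans[OF _ g(1)]] by (fastforce simp: comp_def)
  then have "bij_betw h {n + 2..<n + m + 4} ({1} \<times> {..<n + 2})"
    by (rule bij_betw_cong[THEN iffD1, rotated]) (simp add: h_def)
  moreover have "bij_betw h {..<n + 2} ({0} \<times> {..<n + 2})"
    by (auto simp: h_def bij_betw_def inj_on_def)
  ultimately have "bij_betw h ({n + 2..<n + m + 4} \<union> {..<n + 2})
      ({1} \<times> {..<n + 2} \<union> {0} \<times> {..<n + 2})"
    by (intro bij_betw_combine) auto
  moreover have "{n + 2..<n + m + 4} \<union> {..<n + 2} = ?V"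
      "{1} \<times> {..<n + 2} \<union> {0} \<times> {..<n + 2} = {..<2 :: nat} \<times> {..<n + 2}"
    by auto
  ultimately have bij: "bij_betw h ?V ({..<2} \<times> {..<n + 2})"
    by simp
  have g_less: "g i < n + 2" if "i < m + 2" for i
    using g(1) that by (auto simp: bij_betw_def)
  have AB: "pair_pseudo_graph ?A" "pair_pseudo_graph ?B" "pair_pseudo_graph (graph_of (n + m + 4) ?U)"
    using cone_adj_sym[of E, OF E] cone_union_adj_sym[of E F, OF E F]
    by (auto intro!: pair_pseudo_graph_graph_of)
  have "?U u v \<longleftrightarrow> (h u, h v) \<in> parcs (direct_product ?A ?B)" if "u < n + m + 4" "v < n + m + 4" for u v
    using that g(2)[of "u - (n + 2)" "v - (n + 2)"] g_less[of "u - (n + 2)"] g_less[of "v - (n + 2)"]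
    by (auto simp: direct_product_def graph_of_def h_def cone_union_adj_def union_adj_def)
  then have "graph_iso (graph_of (n + m + 4) ?U) (direct_product ?A ?B)"
    unfolding graph_iso_iff[OF AB(3) pair_pseudo_graph_direct_product[OF AB(1,2)]]
    using bij by (intro exI[of _ h]) (simp add: graph_of_def direct_product_def)
  moreover have "nontrivial ?A" "nontrivial ?B"
    by (simp_all add: nontrivial_def graph_of_def)
  ultimately show ?thesis
    unfolding composite_def using AB by blast
qed

section \<open>A structured language for Turing machines\<close>

text \<open>All tests are for symbol \<open>2\<close>, so a blank behaves like the bit \<open>0\<close>.\<close>

datatype cmd =
    Move nat move
  | Put nat bool
  | Seq cmd cmd (infixr ";;" 60)
  | IfOne nat cmd cmd
  | WhileOne nat cmd

text \<open>The bound makes a nonexistent tape read as not \<open>2\<close>, in agreement with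
  \<open>one_at\<close>, so \<open>exec_compile\<close> needs no assumption on tape numbers.\<close>

definition reads_one :: "nat \<Rightarrow> tape list \<Rightarrow> bool" where
  "reads_one k s \<longleftrightarrow> k < length s \<and> fst (s ! k) (snd (s ! k)) = 2"

text \<open>\<open>L\<close> bounds the number of rounds of each loop, so a run also certifies its
  running time. A relation is used because a loop that needs more rounds has no result.\<close>

primrec exec :: "nat \<Rightarrow> cmd \<Rightarrow> tape list \<Rightarrow> tape list \<Rightarrow> bool" where
  "exec L (Move k d) s s' \<longleftrightarrow> s' = s[k := act (fst (s ! k) (snd (s ! k)), d) (s ! k)]"
| "exec L (Put k b) s s' \<longleftrightarrow> s' = s[k := act (if b then 2 else 1, MoveRight) (s ! k)]"
| "exec L (c1 ;; c2) s s' \<longleftrightarrow> (\<exists>s1. exec L c1 s s1 \<and> exec L c2 s1 s')"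
| "exec L (IfOne k c1 c2) s s' \<longleftrightarrow> (if reads_one k s then exec L c1 s s' else exec L c2 s s')"
| "exec L (WhileOne k c) s s' \<longleftrightarrow>
     (\<exists>j \<sigma>. j \<le> L \<and> \<sigma> 0 = s \<and> \<sigma> j = s' \<and> \<not> reads_one k s' \<and>
        (\<forall>i<j. reads_one k (\<sigma> i) \<and> exec L c (\<sigma> i) (\<sigma> (Suc i))))"

primrec code_length :: "cmd \<Rightarrow> nat" where
  "code_length (Move k d) = 1"
| "code_length (Put k b) = 1"
| "code_length (c1 ;; c2) = code_length c1 + code_length c2"
| "code_length (IfOne k c1 c2) = 1 + code_length c1 + code_length c2"
| "code_length (WhileOne k c) = 1 + code_length c"

section \<open>Compilation to Turing machines\<close>

definition keep :: "nat list \<Rightarrow> (nat \<times> move) list" where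
  "keep = map (\<lambda>s. (s, Stay))"

definition one_at :: "nat \<Rightarrow> nat list \<Rightarrow> bool" where
  "one_at k ss \<longleftrightarrow> k < length ss \<and> ss ! k = 2"

text \<open>\<open>compile c p e\<close> is the code of \<open>c\<close> with first state \<open>p\<close> and exit state \<open>e\<close>.\<close>

primrec compile :: "cmd \<Rightarrow> nat \<Rightarrow> nat \<Rightarrow> (nat list \<Rightarrow> nat \<times> (nat \<times> move) list) list" where
  "compile (Move k d) p e = [\<lambda>ss. (e, (keep ss)[k := (ss ! k, d)])]"
| "compile (Put k b) p e = [\<lambda>ss. (e, (keep ss)[k := (if b then 2 else 1, MoveRight)])]"
| "compile (c1 ;; c2) p e =
     compile c1 p (p + code_length c1) @ compile c2 (p + code_length c1) e"
| "compile (IfOne k c1 c2) p e =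
     (\<lambda>ss. (if one_at k ss then Suc p else Suc p + code_length c1, keep ss)) #
       compile c1 (Suc p) e @ compile c2 (Suc p + code_length c1) e"
| "compile (WhileOne k c) p e =
     (\<lambda>ss. (if one_at k ss then Suc p else e, keep ss)) # compile c (Suc p) p"

lemma length_compile [simp]: "length (compile c p e) = code_length c"
  by (induction c arbitrary: p e) auto

definition machine_of :: "nat \<Rightarrow> (nat list \<Rightarrow> nat \<times> (nat \<times> move) list) list \<Rightarrow> turing_machine" where
  "machine_of K P =
     \<lparr> num_tapes = K, num_symbols = 3, num_states = length P, transition = (\<lambda>q. P ! q) \<rparr>"

text \<open>The condition of \<open>wf_tm\<close> on a single state of a machine with three symbols
  and halting state \<open>E\<close>.\<close>

definition well_behaved :: "nat \<Rightarrow> (nat list \<Rightarrow> nat \<times> (nat \<times> move) list) \<Rightarrow> bool" where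
  "well_behaved E g \<longleftrightarrow> (\<forall>ss. set ss \<subseteq> {..<3} \<longrightarrow>
     fst (g ss) \<le> E \<and> length (snd (g ss)) = length ss \<and> fst ` set (snd (g ss)) \<subseteq> {..<3})"

lemma well_behaved_keep:
  "(\<And>ss. t ss \<le> E) \<Longrightarrow> well_behaved E (\<lambda>ss. (t ss, keep ss))"
  by (auto simp: well_behaved_def keep_def)

lemma well_behaved_update:
  assumes "\<And>ss. set ss \<subseteq> {..<3} \<Longrightarrow> k < length ss \<Longrightarrow> fst (u ss) < 3" "e \<le> E"
  shows "well_behaved E (\<lambda>ss. (e, (keep ss)[k := u ss]))"
  unfolding well_behaved_def
proof (intro allI impI)
  fix ss :: "nat list"
  assume ss: "set ss \<subseteq> {..<3}"
  have "fst ` set ((keep ss)[k := u ss]) \<subseteq> {..<3}"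
  proof (cases "k < length ss")
    case True
    have "set ((keep ss)[k := u ss]) \<subseteq> insert (u ss) (set (keep ss))"
      by (rule set_update_subset_insert)
    moreover have "fst ` set (keep ss) \<subseteq> {..<3}"
      using ss by (auto simp: keep_def)
    ultimately show ?thesis
      using assms(1)[OF ss True] by fastforce
  next
    case False
    then show ?thesis
      using ss by (auto simp: keep_def list_update_beyond)
  qed
  then show "fst (e, (keep ss)[k := u ss]) \<le> E \<and>
      length (snd (e, (keep ss)[k := u ss])) = length ss \<and>
      fst ` set (snd (e, (keep ss)[k := u ss])) \<subseteq> {..<3}"
    using assms(2) by (simp add: keep_def)
qed

lemma well_behaved_compile:
  "g \<in> set (compile c p e) \<Longrightarrow> p + code_length c \<le> E \<Longrightarrow> e \<le> E \<Longrightarrow> well_behaved E g"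
proof (induction c arbitrary: p e)
  case (Move k d)
  then show ?case
    by (auto intro!: well_behaved_update) (meson lessThan_iff nth_mem subsetD)
next
  case (Put k b)
  then show ?case
    by (auto intro!: well_behaved_update)
next
  case (Seq c1 c2)
  then show ?case
    by (auto simp: add.assoc)
next
  case (IfOne k c1 c2)
  from IfOne.prems(1) consider
      "g = (\<lambda>ss. (if one_at k ss then Suc p else Suc p + code_length c1, keep ss))"
    | "g \<in> set (compile c1 (Suc p) e)" | "g \<in> set (compile c2 (Suc p + code_length c1) e)"
    by auto
  then show ?case
  proof cases
    case 1
    show ?thesis
      unfolding 1 using IfOne.prems by (intro well_behaved_keep) auto
  next
    case 2
    then show ?thesis
      using IfOne by auto
  next
    case 3
    then show ?thesis
      using IfOne.IH(2)[of "Suc p + code_length c1" e] IfOne.prems by auto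
  qed
next
  case (WhileOne k c)
  from WhileOne.prems(1) consider
      "g = (\<lambda>ss. (if one_at k ss then Suc p else e, keep ss))" | "g \<in> set (compile c (Suc p) p)"
    by auto
  then show ?case
  proof cases
    case 1
    show ?thesis
      unfolding 1 using WhileOne.prems by (intro well_behaved_keep) auto
  next
    case 2
    then show ?thesis
      using WhileOne by auto
  qed
qed

lemma wf_tm_compile:
  assumes "K \<ge> 2"
  shows "wf_tm (machine_of K (compile c 0 (code_length c)))"
proof -
  have "well_behaved (code_length c) (compile c 0 (code_length c) ! q)" if "q < code_length c" for q
    using that by (auto intro!: well_behaved_compile[of _ c 0 "code_length c"])
  then show ?thesis
    using assms by (auto simp: wf_tm_def machine_of_def well_behaved_def case_prod_beta)
qed

section \<open>Correctness and running time of compiled code\<close>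

lemma map2_act_keep: "map2 act (keep (map (\<lambda>(c, h). c h) s)) s = s"
proof (induction s)
  case (Cons a s)
  then show ?case
    by (cases a) (simp add: keep_def)
qed (simp add: keep_def)

lemma map2_act_update:
  "map2 act ((keep (map (\<lambda>(c, h). c h) s))[k := u]) s = s[k := act u (s ! k)]"
proof (cases "k < length s")
  case True
  \<comment> \<open>Writing \<open>s\<close> as an update of itself turns both arguments into
    updates at \<open>k\<close>, which then commute with \<open>zip\<close> and
    \<open>map\<close>.\<close>
  have "map2 act ((keep (map (\<lambda>(c, h). c h) s))[k := u]) (s[k := s ! k]) =
      (map2 act (keep (map (\<lambda>(c, h). c h) s)) s)[k := act u (s ! k)]"
    unfolding zip_update map_update by simp
  then show ?thesis
    by (simp add: map2_act_keep)
next
  case False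
  then have "(keep (map (\<lambda>(c, h). c h) s))[k := u] = keep (map (\<lambda>(c, h). c h) s)" "s[k := v] = s" for v
    by (simp_all add: keep_def list_update_beyond)
  then show ?thesis
    by (simp add: map2_act_keep)
qed

text \<open>States are positions in the code; splitting the code at the current state exposes its
  transition.\<close>

lemma step_machine_of:
  "step (machine_of K (xs @ g # ys)) (length xs, s) =
     (case g (map (\<lambda>(c, h). c h) s) of (q, as) \<Rightarrow> (q, map2 act as s))"
  by (simp add: step_def machine_of_def)

lemma one_at_reads: "one_at k (map (\<lambda>(c, h). c h) s) = reads_one k s"
  by (auto simp: one_at_def reads_one_def case_prod_beta)

text \<open>A branch is charged for both alternatives, to stay within polynomials. The factor
  \<open>[:1, 1:]\<close> stands for \<open>L + 1\<close>: at most \<open>L\<close> rounds and the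
  final failing test.\<close>

primrec cost :: "cmd \<Rightarrow> nat poly" where
  "cost (Move k d) = 1"
| "cost (Put k b) = 1"
| "cost (c1 ;; c2) = cost c1 + cost c2"
| "cost (IfOne k c1 c2) = 1 + cost c1 + cost c2"
| "cost (WhileOne k c) = [:1, 1:] * (1 + cost c)"

lemma funpow_steps:
  "(f ^^ t1) a = b \<Longrightarrow> (f ^^ t2) b = c \<Longrightarrow> (f ^^ (t1 + t2)) a = c"
  by (simp add: add.commute[of t1] funpow_add)

text \<open>The code may sit anywhere in \<open>P\<close> and leave to any state \<open>e\<close>,
  since the induction meets subcommands inside a larger program.\<close>

lemma exec_compile:
  "exec L c s s' \<Longrightarrow> P = xs @ compile c (length xs) e @ ys \<Longrightarrow>
     \<exists>t \<le> poly (cost c) L. (step (machine_of K P) ^^ t) (length xs, s) = (e, s')"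
proof (induction c arbitrary: s s' xs e ys)
  case (Move k d)
  then have "(step (machine_of K P) ^^ 1) (length xs, s) = (e, s')"
    by (cases "k < length s") (simp_all add: step_machine_of map2_act_update case_prod_beta list_update_beyond)
  then show ?case
    by (intro exI[of _ 1]) simp
next
  case (Put k b)
  then have "(step (machine_of K P) ^^ 1) (length xs, s) = (e, s')"
    by (simp add: step_machine_of map2_act_update)
  then show ?case
    by (intro exI[of _ 1]) simp
next
  case (Seq c1 c2)
  then obtain s1 where s1: "exec L c1 s s1" "exec L c2 s1 s'"
    by auto
  obtain t1 where t1: "t1 \<le> poly (cost c1) L"
      "(step (machine_of K P) ^^ t1) (length xs, s) = (length xs + code_length c1, s1)"
    using Seq.IH(1)[OF s1(1), of xs "length xs + code_length c1"
        "compile c2 (length xs + code_length c1) e @ ys"] Seq.prems(2) by auto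
  obtain t2 where t2: "t2 \<le> poly (cost c2) L"
      "(step (machine_of K P) ^^ t2) (length xs + code_length c1, s1) = (e, s')"
    using Seq.IH(2)[OF s1(2), of "xs @ compile c1 (length xs) (length xs + code_length c1)" e ys]
      Seq.prems(2) by auto
  show ?case
    using funpow_steps[OF t1(2) t2(2)] t1(1) t2(1) by (intro exI[of _ "t1 + t2"]) auto
next
  case (IfOne k c1 c2)
  let ?g = "\<lambda>ss. (if one_at k ss then Suc (length xs) else Suc (length xs) + code_length c1, keep ss)"
  have first: "(step (machine_of K P) ^^ 1) (length xs, s) =
      (if reads_one k s then Suc (length xs) else Suc (length xs) + code_length c1, s)"
    using IfOne.prems(2) by (simp add: step_machine_of one_at_reads map2_act_keep)
  show ?case
  proof (cases "reads_one k s")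
    case True
    then obtain t where "t \<le> poly (cost c1) L"
        "(step (machine_of K P) ^^ t) (Suc (length xs), s) = (e, s')"
      using IfOne.IH(1)[of s s' "xs @ [?g]" e
          "compile c2 (Suc (length xs) + code_length c1) e @ ys"] IfOne.prems by auto
    then show ?thesis
      using True funpow_steps[OF first] by (intro exI[of _ "1 + t"]) auto
  next
    case False
    then obtain t where "t \<le> poly (cost c2) L"
        "(step (machine_of K P) ^^ t) (Suc (length xs) + code_length c1, s) = (e, s')"
      using IfOne.IH(2)[of s s' "xs @ [?g] @ compile c1 (Suc (length xs)) e" e ys]
        IfOne.prems by auto
    then show ?thesis
      using False funpow_steps[OF first] by (intro exI[of _ "1 + t"]) auto
  qed
next
  case (WhileOne k c)
  let ?g = "\<lambda>ss. (if one_at k ss then Suc (length xs) else e, keep ss)"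
  let ?C = "1 + poly (cost c) L"
  have test: "(step (machine_of K P) ^^ 1) (length xs, r) =
      (if reads_one k r then Suc (length xs) else e, r)" for r
    using WhileOne.prems(2) by (simp add: step_machine_of one_at_reads map2_act_keep)
  from WhileOne.prems(1) obtain j \<sigma> where j: "j \<le> L" "\<sigma> 0 = s" "\<sigma> j = s'" "\<not> reads_one k s'"
    and body: "\<And>i. i < j \<Longrightarrow> reads_one k (\<sigma> i)" "\<And>i. i < j \<Longrightarrow> exec L c (\<sigma> i) (\<sigma> (Suc i))"
    by auto
  \<comment> \<open>After \<open>i\<close> rounds, each one test and one run of the body, the
    machine is back at the test with tapes \<open>\<sigma> i\<close>.\<close>
  have "\<exists>t \<le> i * ?C. (step (machine_of K P) ^^ t) (length xs, s) = (length xs, \<sigma> i)"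
    if "i \<le> j" for i
    using that
  proof (induction i)
    case 0
    then show ?case
      using j(2) by (intro exI[of _ 0]) auto
  next
    case (Suc i)
    then obtain t where t: "t \<le> i * ?C"
        "(step (machine_of K P) ^^ t) (length xs, s) = (length xs, \<sigma> i)"
      by auto
    obtain t' where t': "t' \<le> poly (cost c) L"
        "(step (machine_of K P) ^^ t') (Suc (length xs), \<sigma> i) = (length xs, \<sigma> (Suc i))"
      using WhileOne.IH[OF body(2), of i "xs @ [?g]" "length xs" ys] WhileOne.prems(2) Suc.prems
      by auto
    have "(step (machine_of K P) ^^ 1) (length xs, \<sigma> i) = (Suc (length xs), \<sigma> i)"
      using test body(1) Suc.prems by simp
    from funpow_steps[OF t(2) funpow_steps[OF this t'(2)]] show ?case
      using t(1) t'(1) by (intro exI[of _ "t + (1 + t')"]) auto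
  qed
  then obtain t where t: "t \<le> j * ?C"
      "(step (machine_of K P) ^^ t) (length xs, s) = (length xs, s')"
    using j(3) by auto
  have "(step (machine_of K P) ^^ 1) (length xs, s') = (e, s')"
    using test j(4) by simp
  from funpow_steps[OF t(2) this]
  have "(step (machine_of K P) ^^ (t + 1)) (length xs, s) = (e, s')" .
  moreover have "j * ?C \<le> L * ?C"
    using j(1) by (rule mult_le_mono1)
  then have "t + 1 \<le> poly (cost (WhileOne k c)) L"
    using t(1) by (simp add: algebra_simps)
  ultimately show ?case
    by blast
qed

lemma step_halted: "(step (machine_of K P) ^^ t) (length P, s) = (length P, s)"
  by (induction t) (auto simp: step_def machine_of_def)

lemma polytime_computable_exec:
  assumes K: "K \<ge> 2"
    and run: "\<And>x. \<exists>s. exec (length x) c ((cells_of x, 0) # replicate (K - 1) (cells_of [], 0)) s \<and>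
      fst (s ! 1) = cells_of (f x)"
  shows "polytime_computable f"
proof -
  let ?P = "compile c 0 (code_length c)"
  let ?M = "machine_of K ?P"
  have "outputs_within ?M x (poly (cost c) (length x)) (f x)" for x
  proof -
    obtain s where s: "exec (length x) c ((cells_of x, 0) # replicate (K - 1) (cells_of [], 0)) s"
        "fst (s ! 1) = cells_of (f x)"
      using run by blast
    obtain t where t: "t \<le> poly (cost c) (length x)"
        "(step ?M ^^ t) (start_config ?M x) = (code_length c, s)"
      using exec_compile[OF s(1), of ?P "[]" "code_length c" "[]" K]
      by (auto simp: start_config_def machine_of_def)
    \<comment> \<open>The exit state of the whole program is the halting state, so a run that ends
      early can be padded to exactly the time bound.\<close>
    have "(step ?M ^^ (poly (cost c) (length x) - t)) (code_length c, s) = (code_length c, s)"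
      using step_halted[of _ K ?P] by simp
    from funpow_steps[OF t(2) this]
    have "(step ?M ^^ poly (cost c) (length x)) (start_config ?M x) = (code_length c, s)"
      using t(1) by simp
    then show ?thesis
      using s(2) by (simp add: outputs_within_def machine_of_def)
  qed
  then show ?thesis
    unfolding polytime_computable_def using wf_tm_compile[OF K] by blast
qed

section \<open>A program computing the reduction\<close>

definition emit :: "bool \<Rightarrow> bool \<Rightarrow> cmd" where
  "emit b b' = Put 1 b ;; Put 1 b'"

text \<open>The head may stand on the blank behind the last one, hence the step to the left before
  the loop.\<close>

definition rewind :: "nat \<Rightarrow> cmd" where
  "rewind k = Move k MoveLeft ;; WhileOne k (Move k MoveLeft) ;; Move k MoveRight"

text \<open>Tape \<open>k\<close> is a unary counter whose head rests on its first cell outside the loop.\<close>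

definition repeat :: "nat \<Rightarrow> cmd \<Rightarrow> cmd" where
  "repeat k c = WhileOne k (c ;; Move k MoveRight) ;; rewind k"

text \<open>Two counters per number allow nested loops over its square. The number is also sent to
  the output, whose own node count is the sum of both numbers and four. The last move skips the
  separator.\<close>

definition load :: "nat \<Rightarrow> nat \<Rightarrow> cmd" where
  "load k k' = WhileOne 0 (Put 1 True ;; Put k True ;; Put k' True ;; Move 0 MoveRight) ;;
     rewind k ;; rewind k' ;; Move 0 MoveRight"

definition copy_bit :: cmd where
  "copy_bit = IfOne 0 (Put 1 True) (Put 1 False) ;; Move 0 MoveRight"

text \<open>\<open>c\<close> writes one entry, and \<open>b\<close> is the entry in the column of
  \<open>x\<close>. The zeros fill the columns of the other cone. Tape 2 stays free for the loop
  over the rows, as tape 4 does in \<open>right_row\<close>.\<close>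

definition left_row :: "cmd \<Rightarrow> bool \<Rightarrow> cmd" where
  "left_row c b = repeat 3 c ;; emit True b ;; repeat 4 (Put 1 False) ;; emit False False"

definition right_row :: "cmd \<Rightarrow> bool \<Rightarrow> cmd" where
  "right_row c b = repeat 2 (Put 1 False) ;; emit False False ;; repeat 5 c ;; emit True b"

text \<open>
  Tapes 2 and 3 hold the number of nodes of the first graph in unary, tapes 4 and 5 that of the
  second one. After both numbers are known, the input head returns to the first matrix.
\<close>

definition program :: cmd where
  "program =
     load 2 3 ;; repeat 2 (repeat 3 (Move 0 MoveRight)) ;; load 4 5 ;;
     emit True True ;; emit True True ;; Put 1 False ;;
     Move 0 MoveLeft ;; repeat 4 (Move 0 MoveLeft) ;; repeat 2 (repeat 3 (Move 0 MoveLeft)) ;;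
     repeat 2 (left_row copy_bit True) ;;
     left_row (Put 1 True) True ;; left_row (Put 1 True) False ;;
     repeat 4 (Move 0 MoveRight) ;; Move 0 MoveRight ;;
     repeat 4 (right_row copy_bit True) ;;
     right_row (Put 1 True) True ;; right_row (Put 1 True) False"

section \<open>Runs of the program on tape configurations\<close>

definition cfg ::
    "bool list \<Rightarrow> nat \<Rightarrow> bool list \<Rightarrow> nat \<Rightarrow> nat \<Rightarrow> nat \<Rightarrow> nat \<Rightarrow> nat \<Rightarrow> nat \<Rightarrow> tape list" where
  "cfg x i y n a b m c d =
     [(cells_of x, int i), (cells_of y, int (length y)),
      (cells_of (replicate n True), int a), (cells_of (replicate n True), int b),
      (cells_of (replicate m True), int c), (cells_of (replicate m True), int d)]"

text \<open>Behind the input the value is \<open>False\<close>, as a blank is treated by the tests.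
  This describes the run on every bit string, as \<open>polytime_computable\<close> demands.\<close>

definition bit_at :: "bool list \<Rightarrow> nat \<Rightarrow> bool" where
  "bit_at x i \<longleftrightarrow> i < length x \<and> x ! i"

lemma cells_of_eq_2: "cells_of x (int i) = 2 \<longleftrightarrow> bit_at x i"
  by (simp add: cells_of_def bit_at_def)

lemma cells_of_append: "(cells_of y)(int (length y) := if b then 2 else 1) = cells_of (y @ [b])"
  by (auto simp: cells_of_def nth_append fun_eq_iff nat_less_iff)

lemma replicate_Suc_append: "replicate (Suc j) v = replicate j v @ [v]"
  by (simp add: replicate_append_same)

lemma exec_SeqI: "exec L c1 s s1 \<Longrightarrow> exec L c2 s1 s2 \<Longrightarrow> exec L (c1 ;; c2) s s2"
  by auto

lemma exec_WhileOneI: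
  assumes "j \<le> L" "\<And>i. i < j \<Longrightarrow> reads_one k (\<sigma> i)" "\<not> reads_one k (\<sigma> j)"
    "\<And>i. i < j \<Longrightarrow> exec L c (\<sigma> i) (\<sigma> (Suc i))" "s = \<sigma> 0" "s' = \<sigma> j"
  shows "exec L (WhileOne k c) s s'"
  using assms by auto

lemma exec_Move_update:
  assumes "k < length s"
  shows "exec L (Move k d) (s[k := (C, h)]) s' \<longleftrightarrow>
    s' = s[k := (C, case d of MoveLeft \<Rightarrow> h - 1 | Stay \<Rightarrow> h | MoveRight \<Rightarrow> h + 1)]"
  using assms by simp

text \<open>Stated on raw tapes because the head passes through cell \<open>-1\<close>, which
  \<open>cfg\<close> with its natural head positions cannot express.\<close>

lemma exec_rewind:
  assumes "a \<le> L" "k < length s" "a \<le> n"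
  shows "exec L (rewind k) (s[k := (cells_of (replicate n True), int a)])
    (s[k := (cells_of (replicate n True), 0)])"
proof -
  let ?C = "cells_of (replicate n True)"
  let ?\<sigma> = "\<lambda>j. s[k := (?C, int a - int j - 1)]"
  have "exec L (WhileOne k (Move k MoveLeft)) (s[k := (?C, int a - 1)]) (s[k := (?C, - 1)])"
    by (rule exec_WhileOneI[of a _ _ ?\<sigma>])
      (use assms in \<open>auto simp: reads_one_def cells_of_def exec_Move_update simp del: exec.simps\<close>)
  moreover have "exec L (Move k MoveLeft) (s[k := (?C, int a)]) (s[k := (?C, int a - 1)])"
      "exec L (Move k MoveRight) (s[k := (?C, - 1)]) (s[k := (?C, 0)])"
    using assms by (simp_all add: exec_Move_update del: exec.simps)
  ultimately show ?thesis
    unfolding rewind_def by (intro exec_SeqI)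
qed

text \<open>\<open>\<sigma> j\<close> describes the tapes after \<open>j\<close> rounds up to the
  counter tape \<open>k\<close>, which is overwritten with the counter; the body has to leave that
  tape as it was.\<close>

lemma exec_repeat:
  assumes "n \<le> L" "\<And>j. j \<le> n \<Longrightarrow> k < length (\<sigma> j)"
    and "\<And>j. j < n \<Longrightarrow> exec L c ((\<sigma> j)[k := (cells_of (replicate n True), int j)])
      ((\<sigma> (Suc j))[k := (cells_of (replicate n True), int j)])"
  shows "exec L (repeat k c) ((\<sigma> 0)[k := (cells_of (replicate n True), 0)])
    ((\<sigma> n)[k := (cells_of (replicate n True), 0)])"
proof -
  let ?C = "cells_of (replicate n True)"
  have "exec L (WhileOne k (c ;; Move k MoveRight)) ((\<sigma> 0)[k := (?C, 0)]) ((\<sigma> n)[k := (?C, int n)])"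
  proof (rule exec_WhileOneI[of n _ _ "\<lambda>j. (\<sigma> j)[k := (?C, int j)]"])
    show "exec L (c ;; Move k MoveRight) ((\<sigma> j)[k := (?C, int j)]) ((\<sigma> (Suc j))[k := (?C, int (Suc j))])"
      if "j < n" for j
      by (rule exec_SeqI[OF assms(3)[OF that]]) (use assms(2)[of "Suc j"] that in \<open>simp add: add.commute\<close>)
  qed (use assms(1,2) in \<open>auto simp: reads_one_def cells_of_def\<close>)
  then show ?thesis
    unfolding repeat_def using assms(1) assms(2)[of n] by (rule exec_SeqI[OF _ exec_rewind]) auto
qed

lemma exec_right: "exec L (Move 0 MoveRight) (cfg x i y n a b m c d) (cfg x (Suc i) y n a b m c d)"
  by (simp add: cfg_def add.commute)

lemma exec_left: "exec L (Move 0 MoveLeft) (cfg x (Suc i) y n a b m c d) (cfg x i y n a b m c d)"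
  by (simp add: cfg_def)

lemma exec_put: "exec L (Put 1 v) (cfg x i y n a b m c d) (cfg x i (y @ [v]) n a b m c d)"
  using cells_of_append[of y v] by (simp add: cfg_def add.commute)

lemma exec_put_False:
  "exec L (Put 1 False) (cfg x i (y @ replicate j False) n a b m c d)
    (cfg x i (y @ replicate (Suc j) False) n a b m c d)"
  using exec_put[where v = False and y = "y @ replicate j False"]
  by (simp add: replicate_append_same[symmetric] del: exec.simps)

lemma exec_emit: "exec L (emit v w) (cfg x i y n a b m c d) (cfg x i (y @ [v, w]) n a b m c d)"
  unfolding emit_def using exec_SeqI[OF exec_put[where v = v and y = y] exec_put[where v = w and y = "y @ [v]"]]
  by (simp del: exec.simps)

lemma exec_copy_bit:
  "exec L copy_bit (cfg x i y n a b m c d) (cfg x (Suc i) (y @ [bit_at x i]) n a b m c d)"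
proof -
  have "reads_one 0 (cfg x i y n a b m c d) \<longleftrightarrow> bit_at x i"
    by (simp add: reads_one_def cfg_def cells_of_eq_2)
  then have "exec L (IfOne 0 (Put 1 True) (Put 1 False)) (cfg x i y n a b m c d)
      (cfg x i (y @ [bit_at x i]) n a b m c d)"
    using exec_put[where v = True and y = y] exec_put[where v = False and y = y]
    by (simp del: exec.simps(2) add: exec.simps(4))
  then show ?thesis
    unfolding copy_bit_def by (rule exec_SeqI[OF _ exec_right])
qed

text \<open>The factor \<open>1\<close> is kept to match \<open>p * j\<close> in the row lemmas:
  copying advances the input head by \<open>p = 1\<close> per entry, writing a constant by
  \<open>p = 0\<close>.\<close>

lemma exec_copy_bits:
  "exec L copy_bit (cfg x (i + 1 * j) (y @ map (\<lambda>k. bit_at x (i + k)) [0..<j]) n a b m c d)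
    (cfg x (i + 1 * Suc j) (y @ map (\<lambda>k. bit_at x (i + k)) [0..<Suc j]) n a b m c d)"
  using exec_copy_bit[where i = "i + j" and y = "y @ map (\<lambda>k. bit_at x (i + k)) [0..<j]"] by (simp del: exec.simps)

lemma exec_put_True:
  "exec L (Put 1 True) (cfg x (i + 0 * j) (y @ map (\<lambda>_. True) [0..<j]) n a b m c d)
    (cfg x (i + 0 * Suc j) (y @ map (\<lambda>_. True) [0..<Suc j]) n a b m c d)"
  using exec_put[where v = True and i = i and y = "y @ map (\<lambda>_. True) [0..<j]"] by (simp del: exec.simps)

definition left_line :: "nat \<Rightarrow> nat \<Rightarrow> (nat \<Rightarrow> bool) \<Rightarrow> bool \<Rightarrow> bool list" where
  "left_line n m r v = map r [0..<n] @ [True, v] @ replicate (m + 2) False"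

definition right_line :: "nat \<Rightarrow> nat \<Rightarrow> (nat \<Rightarrow> bool) \<Rightarrow> bool \<Rightarrow> bool list" where
  "right_line n m r v = replicate (n + 2) False @ map r [0..<m] @ [True, v]"

context
  fixes L n m :: nat and x :: "bool list"
  assumes n: "n \<le> L" and m: "m \<le> L"
begin

text \<open>This and the next three lemmas specialize \<open>exec_repeat\<close> to the counter
  tapes; \<open>f j\<close> and \<open>g j\<close> are the input head position and the output after
  \<open>j\<close> rounds.\<close>

lemma exec_repeat2:
  assumes "\<And>j. j < n \<Longrightarrow> exec L e (cfg x (f j) (g j) n j b m c d) (cfg x (f (Suc j)) (g (Suc j)) n j b m c d)"
    "i = f 0" "y = g 0" "i' = f n" "y' = g n"
  shows "exec L (repeat 2 e) (cfg x i y n 0 b m c d) (cfg x i' y' n 0 b m c d)"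
  using exec_repeat[OF n, where \<sigma> = "\<lambda>j. cfg x (f j) (g j) n 0 b m c d" and k = 2 and c = e] assms
  by (simp add: cfg_def eval_nat_numeral)

lemma exec_repeat3:
  assumes "\<And>j. j < n \<Longrightarrow> exec L e (cfg x (f j) (g j) n a j m c d) (cfg x (f (Suc j)) (g (Suc j)) n a j m c d)"
    "i = f 0" "y = g 0" "i' = f n" "y' = g n"
  shows "exec L (repeat 3 e) (cfg x i y n a 0 m c d) (cfg x i' y' n a 0 m c d)"
  using exec_repeat[OF n, where \<sigma> = "\<lambda>j. cfg x (f j) (g j) n a 0 m c d" and k = 3 and c = e] assms
  by (simp add: cfg_def eval_nat_numeral)

lemma exec_repeat4:
  assumes "\<And>j. j < m \<Longrightarrow> exec L e (cfg x (f j) (g j) n a b m j d) (cfg x (f (Suc j)) (g (Suc j)) n a b m j d)"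
    "i = f 0" "y = g 0" "i' = f m" "y' = g m"
  shows "exec L (repeat 4 e) (cfg x i y n a b m 0 d) (cfg x i' y' n a b m 0 d)"
  using exec_repeat[OF m, where \<sigma> = "\<lambda>j. cfg x (f j) (g j) n a b m 0 d" and k = 4 and c = e] assms
  by (simp add: cfg_def eval_nat_numeral)

lemma exec_repeat5:
  assumes "\<And>j. j < m \<Longrightarrow> exec L e (cfg x (f j) (g j) n a b m c j) (cfg x (f (Suc j)) (g (Suc j)) n a b m c j)"
    "i = f 0" "y = g 0" "i' = f m" "y' = g m"
  shows "exec L (repeat 5 e) (cfg x i y n a b m c 0) (cfg x i' y' n a b m c 0)"
  using exec_repeat[OF m, where \<sigma> = "\<lambda>j. cfg x (f j) (g j) n a b m c 0" and k = 5 and c = e] assms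
  by (simp add: cfg_def eval_nat_numeral)

lemma exec_left_row:
  assumes "\<And>i y j. j < n \<Longrightarrow> exec L e (cfg x (i + p * j) (y @ map (r i) [0..<j]) n a j m 0 d)
      (cfg x (i + p * Suc j) (y @ map (r i) [0..<Suc j]) n a j m 0 d)"
  shows "exec L (left_row e v) (cfg x i y n a 0 m 0 d)
    (cfg x (i + p * n) (y @ map (r i) [0..<n] @ [True, v] @ replicate (m + 2) False) n a 0 m 0 d)"
proof -
  have 1: "exec L (repeat 3 e) (cfg x i y n a 0 m 0 d) (cfg x (i + p * n) (y @ map (r i) [0..<n]) n a 0 m 0 d)"
    by (rule exec_repeat3[OF assms]) auto
  have 2: "exec L (repeat 4 (Put 1 False)) (cfg x i y n a 0 m 0 d) (cfg x i (y @ replicate m False) n a 0 m 0 d)"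
    for i y
    by (rule exec_repeat4[of _ "\<lambda>_. i" "\<lambda>j. y @ replicate j False"])
      (rule exec_put_False | simp)+
  have "replicate (m + 2) False = replicate m False @ [False, False]"
    by (simp add: replicate_append_same[symmetric])
  then show ?thesis
    unfolding left_row_def
    using exec_SeqI[OF 1 exec_SeqI[OF exec_emit exec_SeqI[OF 2 exec_emit]]]
    by (simp del: exec.simps)
qed

lemma exec_right_row:
  assumes "\<And>i y j. j < m \<Longrightarrow> exec L e (cfg x (i + p * j) (y @ map (r i) [0..<j]) n 0 b m c j)
      (cfg x (i + p * Suc j) (y @ map (r i) [0..<Suc j]) n 0 b m c j)"
  shows "exec L (right_row e v) (cfg x i y n 0 b m c 0)
    (cfg x (i + p * m) (y @ replicate (n + 2) False @ map (r i) [0..<m] @ [True, v]) n 0 b m c 0)"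
proof -
  have 1: "exec L (repeat 5 e) (cfg x i y n 0 b m c 0) (cfg x (i + p * m) (y @ map (r i) [0..<m]) n 0 b m c 0)"
    for y
    by (rule exec_repeat5[OF assms]) auto
  have 2: "exec L (repeat 2 (Put 1 False)) (cfg x i y n 0 b m c 0) (cfg x i (y @ replicate n False) n 0 b m c 0)"
    by (rule exec_repeat2[of _ "\<lambda>_. i" "\<lambda>j. y @ replicate j False"])
      (rule exec_put_False | simp)+
  have "replicate (n + 2) False = replicate n False @ [False, False]"
    by (simp add: replicate_append_same[symmetric])
  then show ?thesis
    unfolding right_row_def
    using exec_SeqI[OF 2 exec_SeqI[OF exec_emit exec_SeqI[OF 1 exec_emit]]]
    by (simp del: exec.simps)
qed

lemma exec_left_copy_row:
  "exec L (left_row copy_bit v) (cfg x i y n a 0 m 0 d)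
    (cfg x (i + n) (y @ left_line n m (\<lambda>k. bit_at x (i + k)) v) n a 0 m 0 d)"
  using exec_left_row[where e = copy_bit and p = 1 and r = "\<lambda>i k. bit_at x (i + k)" and v = v,
      OF exec_copy_bits]
  by (simp add: left_line_def del: exec.simps)

lemma exec_left_matrix:
  "exec L (repeat 2 (left_row copy_bit True)) (cfg x p y n 0 0 m 0 0)
    (cfg x (p + n * n) (y @ concat (map (\<lambda>i. left_line n m (\<lambda>k. bit_at x (p + n * i + k)) True) [0..<n]))
      n 0 0 m 0 0)"
proof (rule exec_repeat2[where f = "\<lambda>j. p + n * j"
      and g = "\<lambda>j. y @ concat (map (\<lambda>i. left_line n m (\<lambda>k. bit_at x (p + n * i + k)) True) [0..<j])"])
  fix j
  show "exec L (left_row copy_bit True)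
      (cfg x (p + n * j) (y @ concat (map (\<lambda>i. left_line n m (\<lambda>k. bit_at x (p + n * i + k)) True) [0..<j]))
        n j 0 m 0 0)
      (cfg x (p + n * Suc j)
        (y @ concat (map (\<lambda>i. left_line n m (\<lambda>k. bit_at x (p + n * i + k)) True) [0..<Suc j])) n j 0 m 0 0)"
    using exec_left_copy_row[where i = "p + n * j" and v = True and
        y = "y @ concat (map (\<lambda>i. left_line n m (\<lambda>k. bit_at x (p + n * i + k)) True) [0..<j])"]
    by (simp add: add.assoc add.commute[of n] del: exec.simps)
qed auto

lemma exec_right_copy_row:
  "exec L (right_row copy_bit v) (cfg x i y n 0 b m c 0)
    (cfg x (i + m) (y @ right_line n m (\<lambda>k. bit_at x (i + k)) v) n 0 b m c 0)"
  using exec_right_row[where e = copy_bit and p = 1 and r = "\<lambda>i k. bit_at x (i + k)" and v = v,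
      OF exec_copy_bits]
  by (simp add: right_line_def del: exec.simps)

lemma exec_right_matrix:
  "exec L (repeat 4 (right_row copy_bit True)) (cfg x p y n 0 0 m 0 0)
    (cfg x (p + m * m) (y @ concat (map (\<lambda>i. right_line n m (\<lambda>k. bit_at x (p + m * i + k)) True) [0..<m]))
      n 0 0 m 0 0)"
proof (rule exec_repeat4[where f = "\<lambda>j. p + m * j"
      and g = "\<lambda>j. y @ concat (map (\<lambda>i. right_line n m (\<lambda>k. bit_at x (p + m * i + k)) True) [0..<j])"])
  fix j
  show "exec L (right_row copy_bit True)
      (cfg x (p + m * j) (y @ concat (map (\<lambda>i. right_line n m (\<lambda>k. bit_at x (p + m * i + k)) True) [0..<j]))
        n 0 0 m j 0)
      (cfg x (p + m * Suc j)
        (y @ concat (map (\<lambda>i. right_line n m (\<lambda>k. bit_at x (p + m * i + k)) True) [0..<Suc j])) n 0 0 m j 0)"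
    using exec_right_copy_row[where i = "p + m * j" and v = True and
        y = "y @ concat (map (\<lambda>i. right_line n m (\<lambda>k. bit_at x (p + m * i + k)) True) [0..<j])"]
    by (simp add: add.assoc add.commute[of m] del: exec.simps)
qed auto

lemma exec_left_cone_row:
  "exec L (left_row (Put 1 True) v) (cfg x i y n 0 0 m 0 0)
    (cfg x i (y @ left_line n m (\<lambda>_. True) v) n 0 0 m 0 0)"
  using exec_left_row[where e = "Put 1 True" and p = 0 and r = "\<lambda>_ _. True" and v = v, OF exec_put_True]
  by (simp add: left_line_def del: exec.simps)

lemma exec_right_cone_row:
  "exec L (right_row (Put 1 True) v) (cfg x i y n 0 0 m 0 0)
    (cfg x i (y @ right_line n m (\<lambda>_. True) v) n 0 0 m 0 0)"
  using exec_right_row[where e = "Put 1 True" and p = 0 and r = "\<lambda>_ _. True" and v = v, OF exec_put_True]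
  by (simp add: right_line_def del: exec.simps)

lemma exec_skip_matrix:
  "exec L (repeat 2 (repeat 3 (Move 0 MoveRight))) (cfg x i y n 0 0 m 0 0) (cfg x (i + n * n) y n 0 0 m 0 0)"
proof (rule exec_repeat2[where f = "\<lambda>j. i + n * j" and g = "\<lambda>_. y"])
  fix j
  show "exec L (repeat 3 (Move 0 MoveRight)) (cfg x (i + n * j) y n j 0 m 0 0)
      (cfg x (i + n * Suc j) y n j 0 m 0 0)"
    by (rule exec_repeat3[where f = "\<lambda>k. i + n * j + k" and g = "\<lambda>_. y"])
      (use exec_right in \<open>simp_all add: algebra_simps del: exec.simps\<close>)
qed auto

text \<open>The head position is written with the number of cells still to be passed; the
  differences are rewritten as successors because \<open>exec_left\<close> starts from a position
  \<open>Suc i\<close>.\<close>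

lemma exec_unskip_matrix:
  "exec L (repeat 2 (repeat 3 (Move 0 MoveLeft))) (cfg x (i + n * n) y n 0 0 m 0 0) (cfg x i y n 0 0 m 0 0)"
proof (rule exec_repeat2[where f = "\<lambda>j. i + n * (n - j)" and g = "\<lambda>_. y"])
  fix j
  assume "j < n"
  then have j: "n * (n - j) = n + n * (n - Suc j)"
    by (metis Suc_diff_Suc mult_Suc_right)
  show "exec L (repeat 3 (Move 0 MoveLeft)) (cfg x (i + n * (n - j)) y n j 0 m 0 0)
      (cfg x (i + n * (n - Suc j)) y n j 0 m 0 0)"
  proof (rule exec_repeat3[where f = "\<lambda>k. i + n * (n - Suc j) + (n - k)" and g = "\<lambda>_. y"])
    fix k
    assume "k < n"
    then have "i + n * (n - Suc j) + (n - k) = Suc (i + n * (n - Suc j) + (n - Suc k))"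
      by simp
    then show "exec L (Move 0 MoveLeft) (cfg x (i + n * (n - Suc j) + (n - k)) y n j k m 0 0)
        (cfg x (i + n * (n - Suc j) + (n - Suc k)) y n j k m 0 0)"
      using exec_left by metis
  qed (simp_all add: j)
qed auto

lemma exec_skip_number:
  "exec L (repeat 4 (Move 0 MoveRight)) (cfg x i y n 0 0 m 0 0) (cfg x (i + m) y n 0 0 m 0 0)"
  by (rule exec_repeat4[where f = "\<lambda>k. i + k" and g = "\<lambda>_. y"])
    (use exec_right in \<open>simp_all del: exec.simps\<close>)

lemma exec_unskip_number:
  "exec L (repeat 4 (Move 0 MoveLeft)) (cfg x (i + m) y n 0 0 m 0 0) (cfg x i y n 0 0 m 0 0)"
proof (rule exec_repeat4[where f = "\<lambda>k. i + (m - k)" and g = "\<lambda>_. y"])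
  fix k
  assume "k < m"
  then have "i + (m - k) = Suc (i + (m - Suc k))"
    by simp
  then show "exec L (Move 0 MoveLeft) (cfg x (i + (m - k)) y n 0 0 m k 0)
      (cfg x (i + (m - Suc k)) y n 0 0 m k 0)"
    using exec_left by metis
qed auto

end

section \<open>Reading the two unary numbers\<close>

definition ones :: "bool list \<Rightarrow> nat \<Rightarrow> nat" where
  "ones x i = length (takeWhile id (drop i x))"

text \<open>This keeps every loop over a number read from the input within the bound
  \<open>L\<close>.\<close>

lemma ones_le: "ones x i \<le> length x"
  using length_takeWhile_le[of id "drop i x"] by (simp add: ones_def)

lemma bit_at_ones:
  assumes "j < ones x i"
  shows "bit_at x (i + j)"
proof -
  have j: "j < length (takeWhile id (drop i x))"
    using assms by (simp add: ones_def)
  then have "takeWhile id (drop i x) ! j"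
    using set_takeWhileD[OF nth_mem[OF j]] by simp
  then have "drop i x ! j"
    by (simp add: takeWhile_nth[OF j])
  moreover have "j < length (drop i x)"
    using j length_takeWhile_le[of id "drop i x"] by (rule less_le_trans)
  ultimately show ?thesis
    by (simp add: bit_at_def less_diff_conv add.commute)
qed

lemma not_bit_at_ones: "\<not> bit_at x (i + ones x i)"
proof
  assume bit: "bit_at x (i + ones x i)"
  then have "ones x i < length (drop i x)"
    by (simp add: bit_at_def less_diff_conv add.commute)
  then have "\<not> drop i x ! ones x i"
    using nth_length_takeWhile[of id "drop i x"] by (simp add: ones_def)
  then show False
    using bit by (simp add: bit_at_def)
qed

lemma six_tapes:
  "[t0, t1, t2, t3, t4, t5] ! 2 = t2" "[t0, t1, t2, t3, t4, t5] ! 3 = t3"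
  "[t0, t1, t2, t3, t4, t5] ! 4 = t4" "[t0, t1, t2, t3, t4, t5] ! 5 = t5"
  "[t0, t1, t2, t3, t4, t5][2 := t] = [t0, t1, t, t3, t4, t5]"
  "[t0, t1, t2, t3, t4, t5][3 := t] = [t0, t1, t2, t, t4, t5]"
  "[t0, t1, t2, t3, t4, t5][4 := t] = [t0, t1, t2, t3, t, t5]"
  "[t0, t1, t2, t3, t4, t5][5 := t] = [t0, t1, t2, t3, t4, t]"
  by (simp_all add: numeral_eq_Suc)

text \<open>Both loads are treated at once. Inside the loop a counter grows with its head behind the
  last one, so its content and both head positions are given by \<open>j\<close>.\<close>

lemma exec_load_loop:
  assumes k: "k = 2 \<and> k' = 3 \<or> k = 4 \<and> k' = 5" and L: "ones x i \<le> L"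
    and \<sigma>: "\<And>j. \<sigma> j = (if k = 2 then cfg x (i + j) (y @ replicate j True) j j j 0 0 0
      else cfg x (i + j) (y @ replicate j True) n 0 0 j j j)"
  shows "exec L (WhileOne 0 (Put 1 True ;; Put k True ;; Put k' True ;; Move 0 MoveRight))
    (\<sigma> 0) (\<sigma> (ones x i))"
proof (rule exec_WhileOneI[of "ones x i" _ _ \<sigma>])
  have reads: "reads_one 0 (\<sigma> j) \<longleftrightarrow> bit_at x (i + j)" for j
    using cells_of_eq_2[of x "i + j"] by (auto simp: \<sigma> reads_one_def cfg_def)
  show "reads_one 0 (\<sigma> j)" if "j < ones x i" for j
    using reads bit_at_ones that by simp
  show "\<not> reads_one 0 (\<sigma> (ones x i))"
    using reads not_bit_at_ones by simp
  have append: "(cells_of (y @ replicate j True))(int j + int (length y) := 2) =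
      cells_of (y @ replicate (Suc j) True)"
    "(cells_of (replicate j True))(int j := 2) = cells_of (replicate (Suc j) True)" for j
    using cells_of_append[of "y @ replicate j True" True] cells_of_append[of "replicate j True" True]
    by (simp_all add: replicate_Suc_append add.commute del: replicate_Suc)
  show "exec L (Put 1 True ;; Put k True ;; Put k' True ;; Move 0 MoveRight) (\<sigma> j) (\<sigma> (Suc j))" for j
    using k by (elim disjE conjE) (simp_all add: \<sigma> cfg_def six_tapes append add.commute del: replicate_Suc)
qed (use L in auto)

lemma exec_load_first:
  assumes "n = ones x i" "n \<le> L"
  shows "exec L (load 2 3) (cfg x i y 0 0 0 0 0 0) (cfg x (Suc (i + n)) (y @ replicate n True) n 0 0 0 0 0)"
proof -
  let ?s = "\<lambda>a b. cfg x (i + n) (y @ replicate n True) n a b 0 0 0"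
  have loop: "exec L (WhileOne 0 (Put 1 True ;; Put 2 True ;; Put 3 True ;; Move 0 MoveRight))
      (cfg x i y 0 0 0 0 0 0) (?s n n)"
    using exec_load_loop[where \<sigma> = "\<lambda>j. cfg x (i + j) (y @ replicate j True) j j j 0 0 0"
        and k = 2 and k' = 3 and i = i and x = x and y = y, folded assms(1), OF _ assms(2)]
    by (simp del: exec.simps)
  have rewind1: "exec L (rewind 2) (?s n n) (?s 0 n)"
    using exec_rewind[of n L 2 "?s n n" n] assms(2) by (simp add: cfg_def six_tapes del: exec.simps)
  have rewind2: "exec L (rewind 3) (?s 0 n) (?s 0 0)"
    using exec_rewind[of n L 3 "?s 0 n" n] assms(2) by (simp add: cfg_def six_tapes del: exec.simps)
  show ?thesis
    unfolding load_def by (rule exec_SeqI[OF loop exec_SeqI[OF rewind1 exec_SeqI[OF rewind2 exec_right]]])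
qed

lemma exec_load_second:
  assumes "m = ones x i" "m \<le> L"
  shows "exec L (load 4 5) (cfg x i y n 0 0 0 0 0) (cfg x (Suc (i + m)) (y @ replicate m True) n 0 0 m 0 0)"
proof -
  let ?s = "\<lambda>a b. cfg x (i + m) (y @ replicate m True) n 0 0 m a b"
  have loop: "exec L (WhileOne 0 (Put 1 True ;; Put 4 True ;; Put 5 True ;; Move 0 MoveRight))
      (cfg x i y n 0 0 0 0 0) (?s m m)"
    using exec_load_loop[where \<sigma> = "\<lambda>j. cfg x (i + j) (y @ replicate j True) n 0 0 j j j"
        and k = 4 and k' = 5 and i = i and x = x and y = y and n = n, folded assms(1), OF _ assms(2)]
    by (simp del: exec.simps)
  have rewind1: "exec L (rewind 4) (?s m m) (?s 0 m)"
    using exec_rewind[of m L 4 "?s m m" m] assms(2) by (simp add: cfg_def six_tapes del: exec.simps)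
  have rewind2: "exec L (rewind 5) (?s 0 m) (?s 0 0)"
    using exec_rewind[of m L 5 "?s 0 m" m] assms(2) by (simp add: cfg_def six_tapes del: exec.simps)
  show ?thesis
    unfolding load_def by (rule exec_SeqI[OF loop exec_SeqI[OF rewind1 exec_SeqI[OF rewind2 exec_right]]])
qed

section \<open>The computed string\<close>

definition union_code ::
    "nat \<Rightarrow> (nat \<Rightarrow> nat \<Rightarrow> bool) \<Rightarrow> nat \<Rightarrow> (nat \<Rightarrow> nat \<Rightarrow> bool) \<Rightarrow> bool list" where
  "union_code n E m F = replicate n True @ replicate m True @ [True, True, True, True, False] @
     concat (map (\<lambda>i. left_line n m (E i) True) [0..<n]) @
     left_line n m (\<lambda>_. True) True @ left_line n m (\<lambda>_. True) False @
     concat (map (\<lambda>i. right_line n m (F i) True) [0..<m]) @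
     right_line n m (\<lambda>_. True) True @ right_line n m (\<lambda>_. True) False"

text \<open>The first matrix starts at \<open>Suc n\<close>, the second code at \<open>p\<close>,
  and the second matrix at \<open>Suc (p + m)\<close>.\<close>

definition reduction :: "bool list \<Rightarrow> bool list" where
  "reduction x =
     (let n = ones x 0; p = Suc n + n * n; m = ones x p in
      union_code n (\<lambda>i j. bit_at x (Suc n + n * i + j)) m (\<lambda>i j. bit_at x (Suc (p + m) + m * i + j)))"

lemma exec_program:
  assumes n: "n = ones x 0" and p: "p = Suc n + n * n" and m: "m = ones x p"
  shows "exec (length x) program (cfg x 0 [] 0 0 0 0 0 0)
    (cfg x (Suc (p + m) + m * m) (reduction x) n 0 0 m 0 0)"
proof -
  have "n \<le> length x" "m \<le> length x"
    using n m ones_le by simp_all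
  note le = this
  \<comment> \<open>The concatenation is bracketed to the left, so that it unifies with the outputs
    of the successive commands.\<close>
  have out: "reduction x = (((((((((((([] @ replicate n True) @ replicate m True) @
      [True, True]) @ [True, True]) @ [False]) @
      concat (map (\<lambda>i. left_line n m (\<lambda>k. bit_at x (Suc n + n * i + k)) True) [0..<n])) @
      left_line n m (\<lambda>_. True) True) @ left_line n m (\<lambda>_. True) False) @
      concat (map (\<lambda>i. right_line n m (\<lambda>k. bit_at x (Suc (p + m) + m * i + k)) True) [0..<m])) @
      right_line n m (\<lambda>_. True) True) @ right_line n m (\<lambda>_. True) False))"
    unfolding reduction_def Let_def n[symmetric] p[symmetric] m[symmetric] union_code_def by simp
  have load: "exec (length x) (load 2 3) (cfg x 0 [] 0 0 0 0 0 0)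
      (cfg x (Suc n) ([] @ replicate n True) n 0 0 0 0 0)"
    using exec_load_first[OF n le(1), of "[]"] by simp
  have first: "exec (length x) (repeat 2 (repeat 3 (Move 0 MoveRight))) (cfg x (Suc n) y n 0 0 0 0 0)
      (cfg x p y n 0 0 0 0 0)" for y
    unfolding p by (rule exec_skip_matrix[OF le(1)]) simp
  have unskip: "exec (length x) (repeat 2 (repeat 3 (Move 0 MoveLeft))) (cfg x p y n 0 0 m 0 0)
      (cfg x (Suc n) y n 0 0 m 0 0)" for y
    unfolding p by (rule exec_unskip_matrix[OF le])
  have left: "exec (length x) (repeat 2 (left_row copy_bit True)) (cfg x (Suc n) y n 0 0 m 0 0)
      (cfg x p (y @ concat (map (\<lambda>i. left_line n m (\<lambda>k. bit_at x (Suc n + n * i + k)) True) [0..<n]))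
        n 0 0 m 0 0)" for y
    unfolding p by (rule exec_left_matrix[OF le])
  \<comment> \<open>The input head goes from \<open>Suc (p + m)\<close> back over
    \<open>p + m\<close> and \<open>p\<close> to \<open>Suc n\<close>. Copying the first matrix
    brings it to \<open>p\<close>, and skipping the second number to
    \<open>Suc (p + m)\<close>.\<close>
  show ?thesis
    unfolding program_def out
    by (rule exec_SeqI load first exec_load_second[OF m le(2)] exec_emit exec_put exec_left
        exec_unskip_number[OF le] unskip left exec_left_cone_row[OF le] exec_skip_number[OF le] exec_right
        exec_right_matrix[OF le] exec_right_cone_row[OF le])+
qed

lemma polytime_computable_reduction: "polytime_computable reduction"
proof (rule polytime_computable_exec[of 6 program])
  show "\<exists>s. exec (length x) program ((cells_of x, 0) # replicate (6 - 1) (cells_of [], 0)) s \<and>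
      fst (s ! 1) = cells_of (reduction x)" for x
    using exec_program[OF refl refl refl, of x] by (auto simp: cfg_def eval_nat_numeral simp del: exec.simps)
qed simp

section \<open>Correctness of the reduction\<close>

definition matrix :: "nat \<Rightarrow> (nat \<Rightarrow> nat \<Rightarrow> bool) \<Rightarrow> bool list" where
  "matrix n E = concat (map (\<lambda>i. map (E i) [0..<n]) [0..<n])"

lemma matrix_nth:
  assumes "i < n" "j < n"
  shows "n * i + j < n * n" "matrix n E ! (n * i + j) \<longleftrightarrow> E i j"
proof -
  \<comment> \<open>The induction is on the number \<open>k\<close> of rows, while the row length
    stays \<open>n\<close>.\<close>
  let ?rows = "\<lambda>k. concat (map (\<lambda>i. map (E i) [0..<n]) [0..<k])"
  have len: "length (?rows k) = n * k" for k
    by (induction k) simp_all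
  have less: "n * i + j < n * k" if "i < k" for i k
  proof -
    have "n * i + j < n * Suc i"
      using assms(2) by simp
    also have "\<dots> \<le> n * k"
      using that by (intro mult_le_mono2) simp
    finally show ?thesis .
  qed
  have "?rows k ! (n * i + j) \<longleftrightarrow> E i j" if "i < k" for k
    using that
  proof (induction k)
    case (Suc k)
    show ?case
    proof (cases "i < k")
      case True
      then show ?thesis
        using Suc.IH less[OF True] len[of k] by (simp add: nth_append)
    next
      case False
      then have "i = k"
        using Suc.prems by simp
      then show ?thesis
        using assms(2) len[of k] by (simp add: nth_append)
    qed
  qed simp
  then show "matrix n E ! (n * i + j) \<longleftrightarrow> E i j"
    using assms(1) by (simp add: matrix_def)
  show "n * i + j < n * n"
    using less assms(1) .
qed

lemma length_matrix: "length (matrix n E) = n * n"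
proof -
  have "length (concat (map (\<lambda>i. map (E i) [0..<n]) [0..<k])) = n * k" for k
    by (induction k) simp_all
  then show ?thesis
    by (simp add: matrix_def)
qed

lemma graph_code_graph_of:
  "graph_code (graph_of n E) = replicate n True @ False # matrix n E"
proof -
  have "map (\<lambda>(i, j). (i, j) \<in> parcs (graph_of n E)) (List.product [0..<n] [0..<n]) =
      concat (map (\<lambda>i. map (\<lambda>j. (i, j) \<in> parcs (graph_of n E)) [0..<n]) [0..<n])"
    by (simp add: product_concat_map map_concat comp_def)
  also have "\<dots> = matrix n E"
    unfolding matrix_def by (intro arg_cong[of _ _ concat] map_cong refl) (simp add: graph_of_def)
  finally show ?thesis
    by (simp add: graph_code_def graph_of_def)
qed

text \<open>The prefix \<open>us\<close> is empty for the first code and the whole first code for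
  the second; the same holds in \<open>bit_at_code\<close>.\<close>

lemma ones_code: "ones (us @ replicate n True @ False # ys) (length us) = n"
  by (simp add: ones_def takeWhile_append)

lemma bit_at_code:
  assumes "i < n" "j < n"
  shows "bit_at (us @ replicate n True @ False # matrix n E @ ys) (Suc (length us + n) + n * i + j) \<longleftrightarrow> E i j"
proof -
  have "us @ replicate n True @ False # matrix n E @ ys =
      (us @ replicate n True @ [False]) @ matrix n E @ ys"
    by simp
  moreover have "Suc (length us + n) + n * i + j = length (us @ replicate n True @ [False]) + (n * i + j)"
    by simp
  moreover have "bit_at (zs @ matrix n E @ ys) (length zs + (n * i + j)) \<longleftrightarrow> E i j" for zs
    using matrix_nth[OF assms] by (simp add: bit_at_def nth_append length_matrix)
  ultimately show ?thesis
    by metis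
qed

lemma reduction_graph_codes:
  "reduction (graph_code (graph_of n E) @ graph_code (graph_of m F)) = union_code n E m F"
proof -
  define x where "x = graph_code (graph_of n E) @ graph_code (graph_of m F)"
  define p where "p = Suc n + n * n"
  let ?us = "replicate n True @ False # matrix n E"
  have x1: "x = [] @ replicate n True @ False # matrix n E @ graph_code (graph_of m F)"
    and x2: "x = ?us @ replicate m True @ False # matrix m F @ []"
    by (simp_all add: x_def graph_code_graph_of)
  have us: "length ?us = p"
    by (simp add: length_matrix p_def)
  have n: "ones x 0 = n"
    using ones_code[of "[]" n] unfolding x1 by simp
  have m: "ones x p = m"
    using ones_code[of ?us m] unfolding x2 us by simp
  have E: "bit_at x (Suc n + n * i + j) \<longleftrightarrow> E i j" if "i < n" "j < n" for i j
    using bit_at_code[OF that, of "[]"] unfolding x1 by simp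
  have F: "bit_at x (Suc (p + m) + m * i + j) \<longleftrightarrow> F i j" if "i < m" "j < m" for i j
    using bit_at_code[OF that, of ?us F "[]"] unfolding x2[symmetric] us .
  have "reduction x = union_code n (\<lambda>i j. bit_at x (Suc n + n * i + j)) m
      (\<lambda>i j. bit_at x (Suc (p + m) + m * i + j))"
    by (simp only: reduction_def Let_def n p_def[symmetric] m)
  also have "\<dots> = union_code n E m F"
  proof -
    have "map (\<lambda>i. left_line n m (\<lambda>j. bit_at x (Suc n + n * i + j)) True) [0..<n] =
        map (\<lambda>i. left_line n m (E i) True) [0..<n]"
      using E by (simp add: left_line_def)
    moreover have "map (\<lambda>i. right_line n m (\<lambda>j. bit_at x (Suc (p + m) + m * i + j)) True) [0..<m] =
        map (\<lambda>i. right_line n m (F i) True) [0..<m]"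
      using F by (simp add: right_line_def)
    ultimately show ?thesis
      by (simp only: union_code_def)
  qed
  finally show ?thesis
    unfolding x_def .
qed

section \<open>The output as the code of the union\<close>

lemma upt_blocks:
  "[0..<n + m + 4] = [0..<n] @ [n, Suc n] @ map (\<lambda>j. n + 2 + j) [0..<m] @ [n + m + 2, n + m + 3]"
proof -
  have append: "[i..<k] = [i..<j] @ [j..<k]" if "i \<le> j" "j \<le> k" for i j k
    using upt_add_eq_append[OF that(1), of "k - j"] that(2) by simp
  have "[0..<n + m + 4] = [0..<n] @ [n..<n + m + 4]"
    by (rule append) simp_all
  also have "[n..<n + m + 4] = [n..<n + 2] @ [n + 2..<n + m + 4]"
    by (rule append) simp_all
  also have "[n + 2..<n + m + 4] = [n + 2..<n + 2 + m] @ [n + 2 + m..<n + m + 4]"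
    by (rule append) simp_all
  finally have "[0..<n + m + 4] = [0..<n] @ [n..<n + 2] @ [n + 2..<n + 2 + m] @ [n + 2 + m..<n + m + 4]" .
  moreover have "[n..<n + 2] = [n, Suc n]" "[n + 2 + m..<n + m + 4] = [n + m + 2, n + m + 3]"
    by (simp_all add: upt_rec)
  moreover have "[n + 2..<n + 2 + m] = map (\<lambda>j. n + 2 + j) [0..<m]"
    using map_add_upt[of "n + 2" m] by (simp add: add.commute)
  ultimately show ?thesis
    by simp
qed

text \<open>Applies both to the entries within a row and to the list of all rows.\<close>

lemma map_upt_blocks:
  "map P [0..<n + m + 4] = map P [0..<n] @ [P n, P (Suc n)] @
     map (\<lambda>j. P (n + 2 + j)) [0..<m] @ [P (n + m + 2), P (n + m + 3)]"
  by (simp only: upt_blocks map_append list.map map_map comp_def)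

lemma map_upt_left_line:
  assumes "\<And>j. j < n \<Longrightarrow> P j = r j" "P n" "P (Suc n) = v"
    and "\<And>j. j < m \<Longrightarrow> \<not> P (n + 2 + j)" "\<not> P (n + m + 2)" "\<not> P (n + m + 3)"
  shows "map P [0..<n + m + 4] = left_line n m r v"
proof -
  have "map P [0..<n] = map r [0..<n]"
    using assms(1) by simp
  moreover have "map (\<lambda>j. P (n + 2 + j)) [0..<m] = replicate m False"
    using assms(4) by (intro nth_equalityI) auto
  ultimately show ?thesis
    unfolding map_upt_blocks left_line_def using assms(2,3,5,6) by (simp add: replicate_app_Cons_same)
qed

lemma map_upt_right_line:
  assumes "\<And>j. j < n \<Longrightarrow> \<not> P j" "\<not> P n" "\<not> P (Suc n)"
    and "\<And>j. j < m \<Longrightarrow> P (n + 2 + j) = r j" "P (n + m + 2)" "P (n + m + 3) = v"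
  shows "map P [0..<n + m + 4] = right_line n m r v"
proof -
  have "map P [0..<n] = replicate n False"
    using assms(1) by (intro nth_equalityI) auto
  moreover have "map (\<lambda>j. P (n + 2 + j)) [0..<m] = map r [0..<m]"
    using assms(4) by simp
  ultimately show ?thesis
    unfolding map_upt_blocks right_line_def using assms(2,3,5,6) by (simp add: replicate_app_Cons_same)
qed

lemma graph_code_cone_union:
  "graph_code (graph_of (n + m + 4) (cone_union_adj n E m F)) = union_code n E m F"
proof -
  let ?row = "\<lambda>i. map (cone_union_adj n E m F i) [0..<n + m + 4]"
  note adj = cone_union_adj_def union_adj_def cone_adj_def
  have left: "?row i = left_line n m (E i) True" if "i < n" for i
    using that by (intro map_upt_left_line) (auto simp: adj)
  have cone_left: "?row n = left_line n m (\<lambda>_. True) True" "?row (Suc n) = left_line n m (\<lambda>_. True) False"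
    by (intro map_upt_left_line; simp add: adj)+
  have right: "?row (n + 2 + i) = right_line n m (F i) True" if "i < m" for i
    using that by (intro map_upt_right_line) (auto simp: adj)
  have cone_right: "?row (n + m + 2) = right_line n m (\<lambda>_. True) True"
      "?row (n + m + 3) = right_line n m (\<lambda>_. True) False"
    by (intro map_upt_right_line; simp add: adj)+
  have "map ?row [0..<n + m + 4] =
      map ?row [0..<n] @ [?row n, ?row (Suc n)] @
      map (\<lambda>i. ?row (n + 2 + i)) [0..<m] @ [?row (n + m + 2), ?row (n + m + 3)]"
    by (rule map_upt_blocks)
  also have "\<dots> = map (\<lambda>i. left_line n m (E i) True) [0..<n] @
      [left_line n m (\<lambda>_. True) True, left_line n m (\<lambda>_. True) False] @
      map (\<lambda>i. right_line n m (F i) True) [0..<m] @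
      [right_line n m (\<lambda>_. True) True, right_line n m (\<lambda>_. True) False]"
    using left right by (simp only: cone_left cone_right) (simp cong: map_cong)
  finally have "matrix (n + m + 4) (cone_union_adj n E m F) = concat \<dots>"
    by (simp only: matrix_def)
  moreover have "replicate (n + m + 4) True = replicate n True @ replicate m True @ [True, True, True, True]"
  proof -
    have "replicate 4 True = [True, True, True, True]"
      by (simp add: numeral_eq_Suc)
    then show ?thesis
      by (simp only: replicate_add append_assoc)
  qed
  ultimately show ?thesis
    by (simp add: graph_code_graph_of union_code_def)
qed

lemma numbered_graph_cone_union:
  assumes "\<And>i j. E i j \<Longrightarrow> E j i" "\<And>i j. F i j \<Longrightarrow> F j i"
  shows "numbered_graph (graph_of (n + m + 4) (cone_union_adj n E m F))"
proof -
  have "pair_pseudo_graph (graph_of (n + m + 4) (cone_union_adj n E m F))"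
    using cone_union_adj_sym[of E F, OF assms] by (rule pair_pseudo_graph_graph_of)
  then show ?thesis
    by (auto simp: numbered_graph_def graph_of_def)
qed

lemma not_connected_cone_union:
  "\<not> connected_graph (graph_of (n + m + 4) (cone_union_adj n E m F))"
  unfolding cone_union_adj_def by (rule not_connected_graph_of_union) simp_all

lemma not_bipartite_cone_union:
  "\<not> bipartite (graph_of (n + m + 4) (cone_union_adj n E m F))"
  by (rule not_bipartite_loop[of n])
    (simp add: graph_of_def cone_union_adj_def union_adj_def cone_adj_def)

theorem theorem3:
  shows "polytime_reducible connected_graph_isomorphism unconnected_nonbipartite_compositeness"
proof -
  have "reduction x \<in> instances unconnected_nonbipartite_compositeness \<and>
      (x \<in> yes_instances connected_graph_isomorphism \<longleftrightarrow>
        reduction x \<in> yes_instances unconnected_nonbipartite_compositeness)"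
    if x_inst: "x \<in> instances connected_graph_isomorphism" for x
  proof -
    obtain G1 G2 where x: "x = graph_code G1 @ graph_code G2"
      and G1: "numbered_graph G1" "connected_graph G1"
      and G2: "numbered_graph G2" "connected_graph G2"
      using x_inst by (auto simp: connected_graph_isomorphism_def)
    obtain n E where E: "G1 = graph_of n E" "\<And>i j. E i j \<Longrightarrow> E j i"
      using numbered_graph_of_adj[OF G1(1)] by blast
    obtain m F where F: "G2 = graph_of m F" "\<And>i j. F i j \<Longrightarrow> F j i"
      using numbered_graph_of_adj[OF G2(1)] by blast
    let ?H = "graph_of (n + m + 4) (cone_union_adj n E m F)"
    have f: "reduction x = graph_code ?H"
      by (simp only: x E(1) F(1) reduction_graph_codes graph_code_cone_union)
    have H: "numbered_graph ?H" "\<not> connected_graph ?H" "\<not> bipartite ?H"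
      using numbered_graph_cone_union[of E F, OF E(2) F(2)] not_connected_cone_union
        not_bipartite_cone_union by blast+
    \<comment> \<open>Membership only says that \<open>x\<close> encodes some isomorphic pair; the
      self-delimiting code identifies that pair with \<open>G1\<close> and
      \<open>G2\<close>.\<close>
    have "x \<in> yes_instances connected_graph_isomorphism \<longleftrightarrow> graph_iso G1 G2"
    proof
      assume "x \<in> yes_instances connected_graph_isomorphism"
      then obtain G1' G2' where x': "graph_code G1 @ graph_code G2 = graph_code G1' @ graph_code G2'"
        and num: "numbered_graph G1'" "numbered_graph G2'" and iso: "graph_iso G1' G2'"
        unfolding x by (auto simp: connected_graph_isomorphism_def)
      from graph_code_append_inject[OF G1(1) num(1) x'] have "G1 = G1'" "graph_code G2 = graph_code G2'"
        by auto
      moreover from this have "G2 = G2'"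
        using graph_code_append_inject[OF G2(1) num(2), of "[]" "[]"] by simp
      ultimately show "graph_iso G1 G2"
        using iso by simp
    next
      assume "graph_iso G1 G2"
      then show "x \<in> yes_instances connected_graph_isomorphism"
        using x G1 G2 by (auto simp: connected_graph_isomorphism_def)
    qed
    also have "\<dots> \<longleftrightarrow> adj_iso n E m F"
      unfolding E(1) F(1) by (rule graph_iso_graph_of[OF E(2) F(2)])
    also have "\<dots> \<longleftrightarrow> composite ?H"
      using composite_cone_union[of E F n m, OF E(2) F(2)]
        composite_cone_union_imp[of E F n m, OF E(2) F(2)] by blast
    also have "\<dots> \<longleftrightarrow> reduction x \<in> yes_instances unconnected_nonbipartite_compositeness"
    proof
      assume "composite ?H"
      then show "reduction x \<in> yes_instances unconnected_nonbipartite_compositeness"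
        using H f by (auto simp: unconnected_nonbipartite_compositeness_def)
    next
      assume "reduction x \<in> yes_instances unconnected_nonbipartite_compositeness"
      then obtain G where "graph_code ?H = graph_code G" "numbered_graph G" "composite G"
        unfolding f by (auto simp: unconnected_nonbipartite_compositeness_def)
      \<comment> \<open>Again by injectivity of the code, \<open>G\<close> is
        \<open>?H\<close>.\<close>
      then show "composite ?H"
        using graph_code_append_inject[OF H(1), of G "[]" "[]"] by simp
    qed
    finally show ?thesis
      using H f by (auto simp: unconnected_nonbipartite_compositeness_def)
  qed
  with polytime_computable_reduction show ?thesis
    unfolding polytime_reducible_def by blast
qed

end
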